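(* Let $\mathbf{d}=(d_1,\dots,d_n)$ be a multigraphical sequence and let $s=\sum_{i=1}^n d_i$ (so every realization has $m=s/2$ edges). Then $\mathbf{d}$ is TC-realizable (as a multigraph) if and only if one of the following holds: (1) $s=4(n-1)-4$ (i.e. $m=2n-4$) and $d_n\ge 2$; or (2) $s\ge 4(n-1)-2$ (i.e. $m\ge 2n-3$), and either (a) $n\le 2$, or (b) $n>2$, $d_{n-1}\ge 2$ and $d_n\ge 1$.
   Context: A degree sequence is a non-increasing sequence $d_1\ge\dots\ge d_n$ of non-negative integers; it is multigraphical if some loopless multigraph (parallel edges allowed) on vertices $v_1,\dots,v_n$ has $\deg(v_i)=d_i$ for all $i$ (a realization). A temporal multigraph is a pair $(G,\lambda)$ where $G$ is a loopless multigraph and $\lambda$ assigns to each edge (each copy of a parallel edge separately) exactly one positive integer label; $\lambda$ is proper if any two distinct edges sharing an endpoint (including parallel copies) receive different labels. A temporal path is a path $e_1,\dots,e_k$ in $G$ whose labels $\lambda(e_1),\dots,\lambda(e_k)$ are non-decreasing (hence strictly increasing for proper labelings). $(G,\lambda)$ is temporally connected if for every ordered pair of vertices $(u,v)$ there is a temporal path from $u$ to $v$. A multigraphical sequence $\mathbf{d}$ is TC-realizable if some multigraph realization $G$ of $\mathbf{d}$ admits a proper labeling $\lambda$ (one label per edge) with $(G,\lambda)$ temporally connected. (Equivalently, a non-simple proper labeling of the underlying simple graph where the number of labels of an edge equals its multiplicity.) *)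

theory Defs
  imports Main
begin

text \<open>
  Edges are abstract identifiers, so parallel edges are distinct elements of \<open>edges G\<close> with the
  same two-element set of endpoints.
\<close>

record ('v, 'e) multigraph =
  verts :: "'v set"
  edges :: "'e set"
  ends :: "'e \<Rightarrow> 'v set"

definition loopless_multigraph :: "('v, 'e) multigraph \<Rightarrow> bool" where
  "loopless_multigraph G \<longleftrightarrow>
     finite (verts G) \<and> finite (edges G) \<and>
     (\<forall>e\<in>edges G. ends G e \<subseteq> verts G \<and> card (ends G e) = 2)"

definition deg :: "('v, 'e) multigraph \<Rightarrow> 'v \<Rightarrow> nat" where
  "deg G v = card {e \<in> edges G. v \<in> ends G e}"

text \<open>
  A sequence \<open>(d\<^sub>1, \<dots>, d\<^sub>n)\<close> is given by its length \<open>n\<close> and a function \<open>d\<close>, of which only the values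
  on \<open>{1..n}\<close> matter; the vertex \<open>v\<^sub>i\<close> is the number \<open>i\<close>. Taking natural numbers as edge
  identifiers loses no finite multigraph up to isomorphism.
\<close>

definition degree_sequence :: "nat \<Rightarrow> (nat \<Rightarrow> nat) \<Rightarrow> bool" where
  "degree_sequence n d \<longleftrightarrow> (\<forall>i j. 1 \<le> i \<and> i \<le> j \<and> j \<le> n \<longrightarrow> d j \<le> d i)"

definition realization :: "(nat, nat) multigraph \<Rightarrow> nat \<Rightarrow> (nat \<Rightarrow> nat) \<Rightarrow> bool" where
  "realization G n d \<longleftrightarrow>
     loopless_multigraph G \<and> verts G = {1..n} \<and> (\<forall>i\<in>{1..n}. deg G i = d i)"

definition multigraphical :: "nat \<Rightarrow> (nat \<Rightarrow> nat) \<Rightarrow> bool" where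
  "multigraphical n d \<longleftrightarrow> degree_sequence n d \<and> (\<exists>G. realization G n d)"

definition labeling :: "('v, 'e) multigraph \<Rightarrow> ('e \<Rightarrow> nat) \<Rightarrow> bool" where
  "labeling G l \<longleftrightarrow> (\<forall>e\<in>edges G. l e > 0)"

definition proper_labeling :: "('v, 'e) multigraph \<Rightarrow> ('e \<Rightarrow> nat) \<Rightarrow> bool" where
  "proper_labeling G l \<longleftrightarrow> labeling G l \<and>
     (\<forall>e\<in>edges G. \<forall>f\<in>edges G. e \<noteq> f \<and> ends G e \<inter> ends G f \<noteq> {} \<longrightarrow> l e \<noteq> l f)"

text \<open>
  A path is described by its edges \<open>es\<close> together with its pairwise distinct vertices \<open>vs\<close>; the
  trivial path (\<open>es = []\<close>) leads from a vertex to itself.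
\<close>

definition path :: "('v, 'e) multigraph \<Rightarrow> 'v \<Rightarrow> 'v list \<Rightarrow> 'e list \<Rightarrow> 'v \<Rightarrow> bool" where
  "path G u vs es v \<longleftrightarrow>
     length vs = Suc (length es) \<and> hd vs = u \<and> last vs = v \<and>
     set vs \<subseteq> verts G \<and> distinct vs \<and> set es \<subseteq> edges G \<and>
     (\<forall>i<length es. ends G (es ! i) = {vs ! i, vs ! Suc i})"

definition temporal_path ::
  "('v, 'e) multigraph \<Rightarrow> ('e \<Rightarrow> nat) \<Rightarrow> 'v \<Rightarrow> 'v list \<Rightarrow> 'e list \<Rightarrow> 'v \<Rightarrow> bool" where
  "temporal_path G l u vs es v \<longleftrightarrow> path G u vs es v \<and> sorted (map l es)"

definition temporally_connected :: "('v, 'e) multigraph \<Rightarrow> ('e \<Rightarrow> nat) \<Rightarrow> bool" where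
  "temporally_connected G l \<longleftrightarrow>
     (\<forall>u\<in>verts G. \<forall>v\<in>verts G. \<exists>vs es. temporal_path G l u vs es v)"

definition TC_realizable :: "nat \<Rightarrow> (nat \<Rightarrow> nat) \<Rightarrow> bool" where
  "TC_realizable n d \<longleftrightarrow>
     (\<exists>G l. realization G n d \<and> proper_labeling G l \<and> temporally_connected G l)"

end

theory Submission
  imports Defs
begin

text \<open>
  Ordering the edges of a properly labelled multigraph by their labels turns it into a sequence of
  telephone calls, and temporal connectedness says that the calls spread all gossip to everybody.

  \<^emph>\<open>Necessity.\<close> The bound \<open>m \<ge> 2n - 4\<close> is the classical gossip theorem; the argument is that of Baker and
  Shostak. In a smallest counterexample nobody hears their own information, since otherwise merging that
  person with the carriers of the information saves one person
    and two calls. Then \<open>m \<ge> 2(n - 1) - deg x + c\<close>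
  where \<open>c\<close> counts the calls useless for \<open>x\<close>, so all degrees are at least 3. The first calls
    and the last
  calls form perfect matchings,
    and at most \<open>n - 5\<close> calls are neither. They fall into at least 5 components, of
  which at most 3 contain calls useful for a given \<open>x\<close>; hence \<open>c \<ge> 1\<close>, all degrees are at least 4, and
  \<open>m \<ge> 2n\<close>, a contradiction. For a vertex of degree 1, everything must be collected at its only
  neighbour before their call,
    and distributed from there afterwards, which takes \<open>2(n - 2) + 1\<close> calls.

  \<^emph>\<open>Sufficiency.\<close> Gather along a forest into a core (a single edge, or a 4-cycle when \<open>m = 2n - 4\<close>), exchange
  inside the core,
    and broadcast along a second forest with the same roots. The numbers of children in both
  forests can be prescribed, which realizes every admissible sequence with \<open>m = 2n - 3\<close> or \<open>m = 2n - 4\<close>.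
  Further edges are appended at the end.
\<close>

section \<open>Sequences of calls\<close>

text \<open>
  \<open>reach xs u v\<close>: the information of \<open>u\<close> has arrived at \<open>v\<close> after the calls \<open>xs\<close>, made one after the other.
\<close>

fun reach :: "'v set list \<Rightarrow> 'v \<Rightarrow> 'v \<Rightarrow> bool" where
  "reach [] u v \<longleftrightarrow> u = v"
| "reach (e # xs) u v \<longleftrightarrow> reach xs u v \<or> (u \<in> e \<and> (\<exists>w\<in>e. reach xs w v))"

definition calls_on :: "'v set \<Rightarrow> 'v set list \<Rightarrow> bool" where
  "calls_on V xs \<longleftrightarrow> (\<forall>e\<in>set xs. e \<subseteq> V \<and> card e = 2)"

definition gossip :: "'v set \<Rightarrow> 'v set list \<Rightarrow> bool" where
  "gossip V xs \<longleftrightarrow> finite V \<and> calls_on V xs \<and> (\<forall>u\<in>V. \<forall>v\<in>V. reach xs u v)"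

lemma reach_refl [simp]: "reach xs u u"
  by (induction xs) auto

lemma reach_append: "reach (xs @ ys) u v \<longleftrightarrow> (\<exists>w. reach xs u w \<and> reach ys w v)"
  by (induction xs arbitrary: u) auto

text \<open>A call acts as a symmetric relation, so reversing the order of the calls inverts their
  composition. This transfers facts about first calls and \<open>out_calls\<close> to last calls and
  \<open>in_calls\<close>.\<close>

lemma reach_rev: "reach (rev xs) u v \<longleftrightarrow> reach xs v u"
  by (induction xs arbitrary: u v) (auto simp: reach_append)

lemma reach_not_occurring: "reach xs u v \<Longrightarrow> u \<notin> \<Union>(set xs) \<Longrightarrow> u = v"
  by (induction xs) auto

lemma reach_not_occurring': "reach xs u v \<Longrightarrow> v \<notin> \<Union>(set xs) \<Longrightarrow> u = v"
  using reach_not_occurring[of "rev xs" v u] by (auto simp: reach_rev)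

lemma reach_in: "reach xs u v \<Longrightarrow> calls_on V xs \<Longrightarrow> u \<in> V \<Longrightarrow> v \<in> V"
  by (induction xs arbitrary: u) (auto simp: calls_on_def)

lemma calls_on_Nil [simp]: "calls_on V []"
  by (simp add: calls_on_def)

lemma calls_on_append [simp]: "calls_on V (xs @ ys) \<longleftrightarrow> calls_on V xs \<and> calls_on V ys"
  by (auto simp: calls_on_def)

lemma calls_on_Cons [simp]: "calls_on V (e # xs) \<longleftrightarrow> e \<subseteq> V \<and> card e = 2 \<and> calls_on V xs"
  by (auto simp: calls_on_def)

lemma calls_on_rev [simp]: "calls_on V (rev xs) \<longleftrightarrow> calls_on V xs"
  by (auto simp: calls_on_def)

lemma gossip_rev: "gossip V (rev xs) \<longleftrightarrow> gossip V xs"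
  by (auto simp: gossip_def reach_rev)

lemma calls_on_nth: "calls_on V xs \<Longrightarrow> i < length xs \<Longrightarrow> xs ! i \<subseteq> V \<and> card (xs ! i) = 2"
  by (simp add: calls_on_def)

section \<open>Merging a person who hears their own information\<close>

text \<open>
  While the information of \<open>x\<close> travels away from \<open>x\<close>
    and back, every call of \<open>x\<close> can be taken over by
  the person currently carrying it. So \<open>x\<close> is identified with a carrier that moves from \<open>p\<close> to \<open>q\<close>;
  the calls with which the information leaves and re-enters \<open>x\<close> become superfluous.
\<close>

definition proj :: "'v \<Rightarrow> 'v \<Rightarrow> 'v \<Rightarrow> 'v" where
  "proj x p u = (if u = x then p else u)"

definition call_step :: "'v set \<Rightarrow> 'v \<Rightarrow> 'v \<Rightarrow> bool" where
  "call_step e u v \<longleftrightarrow> u = v \<or> (u \<in> e \<and> v \<in> e)"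

lemma reach_Cons_step: "reach (e # xs) u v \<longleftrightarrow> (\<exists>w. call_step e u w \<and> reach xs w v)"
  by (auto simp: call_step_def)

definition simulates :: "'v \<Rightarrow> 'v set list \<Rightarrow> 'v \<Rightarrow> 'v set list \<Rightarrow> 'v \<Rightarrow> bool" where
  "simulates x xs p xs' q \<longleftrightarrow> (\<forall>u v. reach xs u v \<longrightarrow> reach xs' (proj x p u) (proj x q v))"

lemma simulates_Nil [simp]: "simulates x [] p [] p"
  by (simp add: simulates_def)

text \<open>Once \<open>x\<close> is identified with \<open>p\<close>, a call between the two is a
  loop; such calls are the ones saved.\<close>

lemma simulates_drop:
  assumes "e = {x, p}" "p \<noteq> x" "simulates x xs p xs' q"
  shows "simulates x (e # xs) p xs' q"
  using assms unfolding simulates_def reach_Cons_step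
  by (auto simp: call_step_def proj_def split: if_splits)

lemma simulates_stay:
  assumes "simulates x xs p xs' q"
  shows "simulates x (e # xs) p ((proj x p ` e) # xs') q"
  unfolding simulates_def reach_Cons_step
proof (intro allI impI, elim exE conjE)
  fix u v w assume "call_step e u w" "reach xs w v"
  then show "\<exists>w. call_step (proj x p ` e) (proj x p u) w \<and> reach xs' w (proj x q v)"
    using assms by (intro exI[of _ "proj x p w"]) (auto simp: simulates_def call_step_def)
qed

text \<open>Handing the role of carrier from \<open>p\<close> to \<open>p'\<close> is free:
  \<open>x\<close> takes no part in \<open>e\<close>, and what was at \<open>x\<close> moves from
  \<open>p\<close> to \<open>p'\<close> along \<open>e\<close> itself.\<close>

lemma simulates_move:
  assumes "simulates x xs p' xs' q" "p \<in> e" "p' \<in> e" "x \<notin> e"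
  shows "simulates x (e # xs) p (e # xs') q"
  unfolding simulates_def reach_Cons_step
proof (intro allI impI, elim exE conjE)
  fix u v w assume "call_step e u w" "reach xs w v"
  then show "\<exists>w. call_step e (proj x p u) w \<and> reach xs' w (proj x q v)"
    using assms by (intro exI[of _ "proj x p' w"]) (auto simp: simulates_def call_step_def proj_def)
qed

lemma simulates_append:
  "simulates x xs p xs' q \<Longrightarrow> simulates x ys q ys' r \<Longrightarrow> simulates x (xs @ ys) p (xs' @ ys') r"
  unfolding simulates_def reach_append by blast

lemma card_2_other: "card e = 2 \<Longrightarrow> x \<in> e \<Longrightarrow> \<exists>y. y \<noteq> x \<and> e = {x, y}"
  by (auto simp: card_2_iff)

lemma simulates_stay_calls:
  assumes "simulates x xs p xs' q" "calls_on (V - {x}) xs'" "e \<subseteq> V" "card e = 2" "p \<in> V" "p \<noteq> x"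
  shows "\<exists>ys. simulates x (e # xs) p ys q \<and> calls_on (V - {x}) ys \<and> length ys \<le> Suc (length xs')"
proof (cases "x \<in> e")
  case False
  then have "proj x p ` e = e" by (auto simp: proj_def image_def)
  then show ?thesis using simulates_stay[OF assms(1), of e] assms False
    by (intro exI[of _ "e # xs'"]) auto
next
  case True
  then obtain y where y: "y \<noteq> x" "e = {x, y}" using card_2_other[OF assms(4)] by blast
  show ?thesis
  proof (cases "y = p")
    case True
    then show ?thesis using simulates_drop[OF _ _ assms(1), of e] y assms
      by (intro exI[of _ xs']) auto
  next
    case False
    have "proj x p ` e = {p, y}" using y by (auto simp: proj_def)
    then show ?thesis using simulates_stay[OF assms(1), of e] y assms False
      by (intro exI[of _ "{p, y} # xs'"]) auto
  qed
qed

lemma simulates_fixed: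
  assumes "calls_on V xs" "p \<in> V" "p \<noteq> x"
  shows "\<exists>ys. simulates x xs p ys p \<and> calls_on (V - {x}) ys \<and> length ys \<le> length xs"
  using assms(1)
proof (induction xs)
  case Nil
  then show ?case by (intro exI[of _ "[]"]) auto
next
  case (Cons e xs)
  then obtain ys where ys: "simulates x xs p ys p" "calls_on (V - {x}) ys" "length ys \<le> length xs"
    by auto
  then show ?case using simulates_stay_calls[OF ys(1,2), of e] Cons.prems assms
    by (force intro: le_trans)
qed

text \<open>The carrier follows a route from \<open>p\<close> to \<open>x\<close>. The final call of
  the route joins the current carrier to \<open>x\<close> and is dropped, whence the strict
  inequality; afterwards the carrier stays fixed.\<close>

lemma simulates_return:
  assumes "calls_on V ys" "reach ys p x" "p \<in> V" "p \<noteq> x"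
  shows "\<exists>q zs. q \<noteq> x \<and> simulates x ys p zs q \<and> calls_on (V - {x}) zs \<and> length zs < length ys"
  using assms
proof (induction ys arbitrary: p)
  case Nil
  then show ?case by simp
next
  case (Cons e ys)
  show ?case
  proof (cases "reach ys p x")
    case True
    with Cons obtain q zs where zs: "q \<noteq> x" "simulates x ys p zs q" "calls_on (V - {x}) zs"
      "length zs < length ys" by fastforce
    then show ?thesis using simulates_stay_calls[OF zs(2,3), of e] Cons.prems
      by (auto intro!: exI[of _ q])
  next
    case False
    then obtain w where w: "p \<in> e" "w \<in> e" "reach ys w x" using Cons.prems by auto
    show ?thesis
    proof (cases "w = x")
      case True
      then have e: "e = {x, p}" using w Cons.prems by (auto simp: card_2_iff)
      obtain zs where zs: "simulates x ys p zs p" "calls_on (V - {x}) zs" "length zs \<le> length ys"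
        using simulates_fixed[of V ys p x] Cons.prems by auto
      then show ?thesis using simulates_drop[OF e _ zs(1)] Cons.prems(4)
        by (intro exI[of _ p] exI[of _ zs]) simp
    next
      case False
      \<comment> \<open>With \<open>x\<close> in the two-element set \<open>e\<close>,
        \<open>w\<close> would equal \<open>p\<close>; but \<open>p\<close> no longer reaches
        \<open>x\<close> after \<open>e\<close>.\<close>
      then have x: "x \<notin> e" using w \<open>\<not> reach ys p x\<close> Cons.prems by (auto simp: card_2_iff)
      obtain q zs where zs: "q \<noteq> x" "simulates x ys w zs q" "calls_on (V - {x}) zs"
        "length zs < length ys" using Cons.IH[of w] Cons.prems w False by auto
      then show ?thesis using simulates_move[OF zs(2) w(1,2) x] Cons.prems x
        by (intro exI[of _ q] exI[of _ "e # zs"]) auto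
    qed
  qed
qed

text \<open>Nobody hears their own information.\<close>

definition noho :: "'v set list \<Rightarrow> bool" where
  "noho xs \<longleftrightarrow> (\<forall>as bs x z. xs = as @ bs \<longrightarrow> reach as x z \<longrightarrow> reach bs z x \<longrightarrow> z = x)"

lemma reach_first_step:
  "reach xs u v \<Longrightarrow> u \<noteq> v \<Longrightarrow> \<exists>as e bs p. xs = as @ e # bs \<and> u \<in> e \<and> p \<in> e \<and> p \<noteq> u \<and> reach bs p v"
proof (induction xs)
  case (Cons e xs)
  show ?case
  proof (cases "reach xs u v")
    case True
    with Cons obtain as f bs p where "xs = as @ f # bs \<and> u \<in> f \<and> p \<in> f \<and> p \<noteq> u \<and> reach bs p v"
      by blast
    then show ?thesis by (intro exI[of _ "e # as"]) auto
  next
    case False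
    then show ?thesis using Cons.prems by (intro exI[of _ "[]"]) auto
  qed
qed auto

text \<open>\<open>x\<close> is merged with its partner \<open>p\<close> in the call by which its
  information leaves. That call is saved, and \<open>simulates_return\<close> saves another one when
  the information comes back.\<close>

lemma gossip_merge:
  assumes "gossip V xs" "\<not> noho xs"
  shows "\<exists>x\<in>V. \<exists>ys. gossip (V - {x}) ys \<and> length ys + 2 \<le> length xs"
proof -
  obtain as0 bs0 x z where xs: "xs = as0 @ bs0" "reach as0 x z" "reach bs0 z x" "z \<noteq> x"
    using assms by (auto simp: noho_def)
  obtain as e cs p where as0: "as0 = as @ e # cs" "x \<in> e" "p \<in> e" "p \<noteq> x" "reach cs p z"
    using reach_first_step[OF xs(2)] xs(4) by blast
  define bs where "bs = cs @ bs0"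
  have bs: "xs = as @ e # bs" "reach bs p x" using xs as0 by (auto simp: bs_def reach_append)
  have on: "calls_on V as" "calls_on V bs" "e \<subseteq> V" "card e = 2"
    using assms(1) bs by (auto simp: gossip_def)
  then have e: "e = {x, p}" "p \<in> V" "x \<in> V" using as0 by (auto simp: card_2_iff)
  obtain as' where as': "simulates x as p as' p" "calls_on (V - {x}) as'" "length as' \<le> length as"
    using simulates_fixed[OF on(1) e(2) as0(4)] by blast
  obtain q bs' where bs': "q \<noteq> x" "simulates x bs p bs' q" "calls_on (V - {x}) bs'"
    "length bs' < length bs"
    using simulates_return[OF on(2) bs(2) e(2) as0(4)] by blast
  have sim: "simulates x xs p (as' @ bs') q"
    unfolding bs(1) by (intro simulates_append[OF as'(1)] simulates_drop e as0 bs')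
  have "gossip (V - {x}) (as' @ bs')"
    using assms(1) as' bs' sim unfolding gossip_def simulates_def
    by (auto simp: proj_def) metis
  moreover have "length (as' @ bs') + 2 \<le> length xs" using as' bs' bs(1) by simp
  ultimately show ?thesis using e(3) by blast
qed

lemma reach_snoc: "reach (xs @ [e]) u v \<longleftrightarrow> reach xs u v \<or> (v \<in> e \<and> (\<exists>w\<in>e. reach xs u w))"
  by (auto simp: reach_append)

section \<open>The lower bound for the gossip problem\<close>

text \<open>
  \<open>out_calls xs x\<close> are the calls by which somebody first learns the information of \<open>x\<close>;
  \<open>in_calls xs x\<close> is the time-reversed notion.
\<close>

definition out_calls :: "'v set list \<Rightarrow> 'v \<Rightarrow> nat set" where
  "out_calls xs x = {i. i < length xs \<and>
     (\<exists>y\<in>xs ! i. \<exists>z\<in>xs ! i. reach (take i xs) x z \<and> \<not> reach (take i xs) x y)}"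

definition in_calls :: "'v set list \<Rightarrow> 'v \<Rightarrow> nat set" where
  "in_calls xs x = {i. i < length xs \<and>
     (\<exists>y\<in>xs ! i. \<exists>z\<in>xs ! i. reach (drop (Suc i) xs) z x \<and> \<not> reach (drop (Suc i) xs) y x)}"

lemma in_calls_rev:
  assumes "i < length xs"
  shows "i \<in> in_calls xs x \<longleftrightarrow> length xs - Suc i \<in> out_calls (rev xs) x"
proof -
  have "take (length xs - Suc i) (rev xs) = rev (drop (Suc i) xs)"
    using assms by (simp add: rev_drop)
  then show ?thesis using assms by (auto simp: in_calls_def out_calls_def rev_nth reach_rev)
qed

text \<open>A call has two participants, so each member of \<open>out_calls\<close> informs one new
  person; the extra 1 is \<open>x\<close> itself.\<close>

lemma card_reached_le:
  assumes "calls_on V xs"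
  shows "finite {y. reach xs x y} \<and> card {y. reach xs x y} \<le> Suc (card (out_calls xs x))"
  using assms
proof (induction xs rule: rev_induct)
  case Nil
  then show ?case by (simp add: out_calls_def)
next
  case (snoc e xs)
  let ?R = "{y. reach xs x y}" and ?R' = "{y. reach (xs @ [e]) x y}"
  have fin: "finite ?R" and IH: "card ?R \<le> Suc (card (out_calls xs x))" using snoc by auto
  have fo: "finite (out_calls (xs @ [e]) x)" by (simp add: out_calls_def)
  have sub: "out_calls xs x \<subseteq> out_calls (xs @ [e]) x" by (auto simp: out_calls_def nth_append)
  show ?case
  proof (cases "e \<inter> ?R \<noteq> {} \<and> \<not> e \<subseteq> ?R")
    case False
    then have "?R' = ?R" by (auto simp: reach_snoc)
    then show ?thesis using fin IH card_mono[OF fo sub] by auto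
  next
    case True
    then obtain z where z: "z \<in> e" "z \<in> ?R" by blast
    then obtain y where y: "e = {z, y}" using card_2_other[of e z] snoc.prems by auto
    have R': "?R' = insert y ?R" using y z by (auto simp: reach_snoc)
    have "length xs \<in> out_calls (xs @ [e]) x" using True z y by (auto simp: out_calls_def)
    moreover have "length xs \<notin> out_calls xs x" by (auto simp: out_calls_def)
    ultimately have "card (out_calls xs x) < card (out_calls (xs @ [e]) x)"
      using psubset_card_mono[OF fo] sub by blast
    then show ?thesis using R' fin IH by (simp add: card_insert_if)
  qed
qed

lemma card_out_calls:
  assumes "gossip V xs" "x \<in> V"
  shows "card V \<le> Suc (card (out_calls xs x))"
proof -
  have "V \<subseteq> {y. reach xs x y}" using assms by (auto simp: gossip_def)
  then show ?thesis using card_reached_le[of V xs x] assms card_mono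
    by (meson gossip_def le_trans)
qed

lemma card_in_calls:
  assumes "gossip V xs" "x \<in> V"
  shows "card V \<le> Suc (card (in_calls xs x))"
proof -
  have "out_calls (rev xs) x = (\<lambda>i. length xs - Suc i) ` in_calls xs x"
  proof -
    have "i \<in> (\<lambda>i. length xs - Suc i) ` in_calls xs x" if "i \<in> out_calls (rev xs) x" for i
    proof -
      have i: "i < length xs" using that by (simp add: out_calls_def)
      then have "length xs - Suc i \<in> in_calls xs x"
        using that in_calls_rev[of "length xs - Suc i" xs x] by simp
      then show ?thesis using i by (intro image_eqI[of _ _ "length xs - Suc i"]) auto
    qed
    moreover have "length xs - Suc i \<in> out_calls (rev xs) x" if "i \<in> in_calls xs x" for i
      using that in_calls_rev[of i xs x] by (auto simp: in_calls_def)
    ultimately show ?thesis by blast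
  qed
  moreover have "finite (in_calls xs x)" by (simp add: in_calls_def)
  ultimately have "card (out_calls (rev xs) x) \<le> card (in_calls xs x)"
    by (simp add: card_image_le)
  then show ?thesis using card_out_calls[of V "rev xs" x] assms by (simp add: gossip_rev)
qed

section \<open>Degree bound when nobody hears their own information\<close>

definition calls_of :: "'v set list \<Rightarrow> 'v \<Rightarrow> nat set" where
  "calls_of xs v = {i. i < length xs \<and> v \<in> xs ! i}"

lemma finite_calls_of [simp]: "finite (calls_of xs v)"
  by (simp add: calls_of_def)

lemma nohoD: "noho xs \<Longrightarrow> reach (take i xs) x z \<Longrightarrow> reach (drop i xs) z x \<Longrightarrow> z = x"
  unfolding noho_def by (metis append_take_drop_id)

lemma noho_rev: "noho xs \<Longrightarrow> noho (rev xs)"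
  unfolding noho_def by (metis reach_rev rev_append rev_rev_ident)

text \<open>In a call counted on both sides, a participant already holding the information of
  \<open>x\<close> meets information that will reach \<open>x\<close>. Under \<open>noho\<close>
  this participant must be \<open>x\<close>.\<close>

lemma out_in_calls:
  assumes "noho xs"
  shows "out_calls xs x \<inter> in_calls xs x \<subseteq> calls_of xs x"
proof
  fix i assume i: "i \<in> out_calls xs x \<inter> in_calls xs x"
  then have il: "i < length xs" by (simp add: out_calls_def)
  obtain z where z: "z \<in> xs ! i" "reach (take i xs) x z" using i by (auto simp: out_calls_def)
  obtain w where w: "w \<in> xs ! i" "reach (drop (Suc i) xs) w x" using i by (auto simp: in_calls_def)
  have "reach (drop i xs) z x" using z w il by (auto simp flip: Cons_nth_drop_Suc)
  then show "i \<in> calls_of xs x" using nohoD[OF assms z(2)] z il by (simp add: calls_of_def)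
qed

text \<open>Inclusion-exclusion: \<open>out_calls\<close> and \<open>in_calls\<close> have at least
  \<open>card V - 1\<close> elements each and overlap only in calls of \<open>x\<close>, while the
  calls in \<open>I\<close> serve \<open>x\<close> in neither direction.\<close>

lemma degree_noho:
  assumes "gossip V xs" "noho xs" "x \<in> V"
    and "I \<subseteq> {..<length xs} - out_calls xs x - in_calls xs x"
  shows "2 * card V + card I \<le> length xs + card (calls_of xs x) + 2"
proof -
  let ?A = "out_calls xs x" and ?B = "in_calls xs x"
  have fin: "finite ?A" "finite ?B" by (auto simp: out_calls_def in_calls_def)
  have finI: "finite I" using assms(4) finite_subset by blast
  have "card ?A + card ?B = card (?A \<union> ?B) + card (?A \<inter> ?B)"
    using card_Un_Int fin by blast
  also have "card (?A \<inter> ?B) \<le> card (calls_of xs x)"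
    using out_in_calls[OF assms(2)] by (intro card_mono) simp_all
  finally have 1: "card ?A + card ?B \<le> card (?A \<union> ?B) + card (calls_of xs x)" by simp
  have "card (?A \<union> ?B) + card I = card (?A \<union> ?B \<union> I)"
    using assms(4) fin finI by (subst card_Un_disjoint) auto
  also have "\<dots> \<le> card {..<length xs}"
    using assms(4) by (intro card_mono) (auto simp: out_calls_def in_calls_def)
  finally show ?thesis using 1 card_out_calls[OF assms(1,3)] card_in_calls[OF assms(1,3)] by simp
qed

section \<open>First and last calls\<close>

definition first_at :: "'v set list \<Rightarrow> nat \<Rightarrow> 'v \<Rightarrow> bool" where
  "first_at xs i x \<longleftrightarrow> i < length xs \<and> x \<in> xs ! i \<and> (\<forall>j<i. x \<notin> xs ! j)"

definition last_at :: "'v set list \<Rightarrow> nat \<Rightarrow> 'v \<Rightarrow> bool" where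
  "last_at xs i x \<longleftrightarrow> i < length xs \<and> x \<in> xs ! i \<and> (\<forall>j. i < j \<and> j < length xs \<longrightarrow> x \<notin> xs ! j)"

lemma last_at_rev: "i < length xs \<Longrightarrow> last_at xs i x \<longleftrightarrow> first_at (rev xs) (length xs - Suc i) x"
proof -
  assume i: "i < length xs"
  have "(\<forall>j. i < j \<and> j < length xs \<longrightarrow> x \<notin> xs ! j) \<longleftrightarrow> (\<forall>j<length xs - Suc i. x \<notin> rev xs ! j)"
  proof (intro iffI allI impI)
    fix j assume "\<forall>j. i < j \<and> j < length xs \<longrightarrow> x \<notin> xs ! j" "j < length xs - Suc i"
    moreover from this(2) have "i < length xs - Suc j \<and> length xs - Suc j < length xs" by linarith
    ultimately show "x \<notin> rev xs ! j" by (simp add: rev_nth)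
  next
    fix j assume a: "\<forall>j<length xs - Suc i. x \<notin> rev xs ! j" and j: "i < j \<and> j < length xs"
    from j have "length xs - Suc j < length xs - Suc i" by linarith
    with a have "x \<notin> rev xs ! (length xs - Suc j)" by blast
    moreover from j have "rev xs ! (length xs - Suc j) = xs ! j" by (subst rev_nth) auto
    ultimately show "x \<notin> xs ! j" by simp
  qed
  then show ?thesis using i by (auto simp: last_at_def first_at_def rev_nth)
qed

lemma first_at_rev: "i < length xs \<Longrightarrow> first_at xs i x \<longleftrightarrow> last_at (rev xs) (length xs - Suc i) x"
  using last_at_rev[of "length xs - Suc i" "rev xs" x] by auto

text \<open>
  If \<open>y\<close> had called \<open>z\<close> before the first call \<open>{x, y}\<close> of \<open>x\<close>, then whatever brings the information of \<open>x\<close>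
  to \<open>z\<close> would also bring \<open>z\<close>'s own information back to \<open>z\<close>.
\<close>

lemma first_at_mutual:
  assumes "gossip V xs" "noho xs" "first_at xs i x" "y \<in> xs ! i"
  shows "first_at xs i y"
proof -
  have i: "i < length xs" "x \<in> xs ! i" "\<And>j. j < i \<Longrightarrow> x \<notin> xs ! j"
    using assms(3) by (auto simp: first_at_def)
  have on: "calls_on V xs" using assms(1) by (simp add: gossip_def)
  have "y \<notin> xs ! j" if "j < i" for j
  proof
    assume y: "y \<in> xs ! j"
    have "card (xs ! j) = 2" using calls_on_nth[OF on, of j] \<open>j < i\<close> i(1) by simp
    then obtain z where z: "z \<noteq> y" "xs ! j = {y, z}" using card_2_other y by metis
    have "x \<in> V" "z \<in> V"
      using calls_on_nth[OF on] i that z(2) by (metis insertCI less_trans subsetD)+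
    then have "reach (take i xs @ drop i xs) x z" using assms(1) by (simp add: gossip_def)
    then obtain u where u: "reach (take i xs) x u" "reach (drop i xs) u z" unfolding reach_append
      by blast
    have "x \<notin> \<Union>(set (take i xs))" using i by (auto simp: in_set_conv_nth)
    then have "u = x" using reach_not_occurring[OF u(1)] by simp
    then have "reach (drop i xs) y z" using u(2) i assms(4) by (auto simp flip: Cons_nth_drop_Suc)
    moreover have "drop (Suc j) xs = take (i - Suc j) (drop (Suc j) xs) @ drop i xs"
      using that by (metis Suc_leI append_take_drop_id drop_drop le_add_diff_inverse2)
    ultimately have "reach (drop (Suc j) xs) y z" by (metis reach_append reach_refl)
    moreover have "reach (take (Suc j) xs) z y"
      using that i z by (auto simp: take_Suc_conv_app_nth reach_snoc)
    ultimately show False using nohoD[OF assms(2)] z(1) by blast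
  qed
  then show ?thesis using i assms(4) by (simp add: first_at_def)
qed

lemma last_at_mutual:
  assumes "gossip V xs" "noho xs" "last_at xs i x" "y \<in> xs ! i"
  shows "last_at xs i y"
proof -
  have "i < length xs" using assms(3) by (simp add: last_at_def)
  then show ?thesis
    using first_at_mutual[of V "rev xs" "length xs - Suc i" x y] assms
    by (simp add: gossip_rev noho_rev last_at_rev rev_nth)
qed

lemma first_at_unique: "first_at xs i x \<Longrightarrow> first_at xs j x \<Longrightarrow> i = j"
  by (auto simp: first_at_def) (metis linorder_neqE_nat)

lemma last_at_unique: "last_at xs i x \<Longrightarrow> last_at xs j x \<Longrightarrow> i = j"
  by (auto simp: last_at_def) (metis linorder_neqE_nat)

definition first_calls :: "'v set list \<Rightarrow> nat set" where
  "first_calls xs = {i. \<exists>x. first_at xs i x}"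

definition last_calls :: "'v set list \<Rightarrow> nat set" where
  "last_calls xs = {i. \<exists>x. last_at xs i x}"

lemma first_at_exists: "calls_of xs v \<noteq> {} \<Longrightarrow> \<exists>i. first_at xs i v"
proof -
  assume "calls_of xs v \<noteq> {}"
  then have "\<exists>i. i < length xs \<and> v \<in> xs ! i" by (auto simp: calls_of_def)
  from exists_least_iff[THEN iffD1, OF this] show ?thesis
    by (auto simp: first_at_def)
qed

lemma calls_of_rev: "calls_of xs v \<noteq> {} \<Longrightarrow> calls_of (rev xs) v \<noteq> {}"
proof -
  assume "calls_of xs v \<noteq> {}"
  then obtain i where "i < length xs" "v \<in> xs ! i" by (auto simp: calls_of_def)
  then have "length xs - Suc i \<in> calls_of (rev xs) v" by (auto simp: calls_of_def rev_nth)
  then show ?thesis by blast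
qed

lemma last_at_exists: "calls_of xs v \<noteq> {} \<Longrightarrow> \<exists>i. last_at xs i v"
proof -
  assume "calls_of xs v \<noteq> {}"
  then obtain i where i: "first_at (rev xs) i v"
    using first_at_exists[of "rev xs" v] calls_of_rev[of xs v] by metis
  then have "i < length xs" by (simp add: first_at_def)
  then show ?thesis using i last_at_rev[of "length xs - Suc i" xs v]
    by (intro exI[of _ "length xs - Suc i"]) auto
qed

lemma first_calls_sub: "first_calls xs \<subseteq> {..<length xs}"
  by (auto simp: first_calls_def first_at_def)

lemma last_calls_sub: "last_calls xs \<subseteq> {..<length xs}"
  by (auto simp: last_calls_def last_at_def)

section \<open>Covers, and closure under a set of calls\<close>

lemma cover_card:
  assumes "calls_on V xs" "I \<subseteq> {..<length xs}" "\<And>v. v \<in> V \<Longrightarrow> \<exists>i\<in>I. v \<in> xs ! i"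
  shows "card V \<le> 2 * card I"
proof -
  have fin: "finite I" using assms(2) finite_subset by blast
  have c: "card (xs ! i) = 2" if "i \<in> I" for i using that assms calls_on_nth by blast
  have "finite (xs ! i)" if "i \<in> I" for i using c[OF that] card.infinite by fastforce
  then have "finite (\<Union>i\<in>I. xs ! i)" using fin by simp
  then have "card V \<le> card (\<Union>i\<in>I. xs ! i)" using assms(3) by (intro card_mono) auto
  also have "\<dots> \<le> (\<Sum>i\<in>I. card (xs ! i))" using fin by (rule card_UN_le)
  also have "\<dots> = 2 * card I" using c by simp
  finally show ?thesis .
qed

text \<open>\<open>T\<close> has maximal size among the sets that pay for each added person with a
  call of \<open>I\<close> inside them; a call crossing its border would pay for one more.\<close>

lemma closed_superset:
  assumes "finite V" "calls_on V xs" "I \<subseteq> {..<length xs}" "S \<subseteq> V"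
  shows "\<exists>T. S \<subseteq> T \<and> T \<subseteq> V \<and> card T \<le> card S + card I \<and>
    (\<forall>i\<in>I. xs ! i \<inter> T \<noteq> {} \<longrightarrow> xs ! i \<subseteq> T)"
proof -
  have fI: "finite I" using assms(3) finite_subset by blast
  let ?P = "\<lambda>T. S \<subseteq> T \<and> T \<subseteq> V \<and> card T \<le> card S + card {i\<in>I. xs ! i \<subseteq> T}"
  have "?P S" using assms by simp
  moreover have "\<forall>T. ?P T \<longrightarrow> card T < Suc (card V)" using assms(1) card_mono less_Suc_eq_le by blast
  ultimately have "\<exists>T. ?P T \<and> (\<forall>T'. ?P T' \<longrightarrow> card T' \<le> card T)"
    by (rule ex_has_greatest_nat[where f = card])
  then obtain T where T: "?P T" and max: "\<And>T'. ?P T' \<Longrightarrow> card T' \<le> card T"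
    by blast
  have fT: "finite T" using T assms(1) finite_subset by blast
  have "xs ! i \<subseteq> T" if i: "i \<in> I" "xs ! i \<inter> T \<noteq> {}" for i
  proof (rule ccontr)
    assume n: "\<not> xs ! i \<subseteq> T"
    obtain p where p: "p \<in> xs ! i" "p \<in> T" using i by blast
    have iV: "xs ! i \<subseteq> V" "card (xs ! i) = 2" using calls_on_nth[OF assms(2)] i assms(3) by blast+
    obtain q where q: "xs ! i = {p, q}" using card_2_other[OF iV(2) p(1)] by blast
    have qT: "q \<notin> T" using n q p by auto
    have "i \<in> {j\<in>I. xs ! j \<subseteq> insert q T}" "i \<notin> {j\<in>I. xs ! j \<subseteq> T}"
      using i q p n by auto
    then have "{j\<in>I. xs ! j \<subseteq> T} \<subset> {j\<in>I. xs ! j \<subseteq> insert q T}" by blast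
    then have "card {j\<in>I. xs ! j \<subseteq> T} < card {j\<in>I. xs ! j \<subseteq> insert q T}"
      using fI by (intro psubset_card_mono) auto
    then have "?P (insert q T)" using T qT fT iV q by auto
    from max[OF this] show False using qT fT by simp
  qed
  moreover have "card {i\<in>I. xs ! i \<subseteq> T} \<le> card I" using fI by (intro card_mono) auto
  ultimately show ?thesis using T by (intro exI[of _ T]) auto
qed

text \<open>
  Apart from its first call, a temporal path leaving \<open>x\<close> uses no first calls,
    and only its final call can
  be a last call.
\<close>

lemma out_calls_closed:
  assumes g: "gossip V xs" "noho xs"
    and T: "x \<in> T"
      "\<And>i. i < length xs \<Longrightarrow> i \<notin> first_calls xs \<Longrightarrow> i \<notin> last_calls xs \<Longrightarrow> xs ! i \<inter> T \<noteq> {} \<Longrightarrow> xs ! i \<subseteq> T"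
    and f: "\<And>i. first_at xs i x \<Longrightarrow> xs ! i \<subseteq> T"
    and i: "i \<in> out_calls xs x" "i \<notin> first_calls xs" "i \<notin> last_calls xs"
  shows "xs ! i \<subseteq> T"
proof -
  have on: "calls_on V xs" using g by (simp add: gossip_def)
  \<comment> \<open>A call of \<open>p\<close> at or after time \<open>j\<close> rules out that
    \<open>p\<close> was informed by its last call.\<close>
  have *: "p \<in> T" if "reach (take j xs) x p" "j \<le> k" "k < length xs" "p \<in> xs ! k" for j k p
    using that
  proof (induction j arbitrary: k p)
    case 0
    then show ?case using T by simp
  next
    case (Suc j)
    have jl: "j < length xs" using Suc.prems by simp
    show ?case
    proof (cases "reach (take j xs) x p")
      case True
      then show ?thesis using Suc.IH[of p k] Suc.prems by simp
    next
      case False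
      then obtain q where q: "p \<in> xs ! j" "q \<in> xs ! j" "reach (take j xs) x q"
        using Suc.prems(1) jl by (auto simp: take_Suc_conv_app_nth reach_snoc)
      have qT: "q \<in> T" using Suc.IH[of q j] q jl by simp
      have nl: "j \<notin> last_calls xs"
      proof
        assume "j \<in> last_calls xs"
        then have "last_at xs j p" using last_at_mutual[OF g] q(1) by (auto simp: last_calls_def)
        then show False using Suc.prems by (auto simp: last_at_def)
      qed
      show ?thesis
      proof (cases "j \<in> first_calls xs")
        case True
        \<comment> \<open>Before its first call \<open>q\<close> holds only its own information, so
          \<open>q = x\<close>.\<close>
        then have fq: "first_at xs j q"
          using first_at_mutual[OF g] q(2) by (auto simp: first_calls_def)
        then have "q \<notin> \<Union>(set (take j xs))" by (auto simp: first_at_def in_set_conv_nth)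
        then have "x = q" using reach_not_occurring'[OF q(3)] by simp
        then show ?thesis using f fq q(1) by blast
      next
        case False
        then show ?thesis using T(2)[OF jl False nl] qT q by blast
      qed
    qed
  qed
  obtain z where "z \<in> xs ! i" "reach (take i xs) x z" "i < length xs"
    using i by (auto simp: out_calls_def)
  with *[of i z i] T(2)[OF _ i(2,3)] show ?thesis by blast
qed

lemma first_calls_rev: "i < length xs \<Longrightarrow> i \<in> first_calls (rev xs) \<longleftrightarrow> length xs - Suc i \<in> last_calls xs"
  using last_at_rev[of "length xs - Suc i" xs] by (auto simp: first_calls_def last_calls_def)

lemma last_calls_rev: "i < length xs \<Longrightarrow> i \<in> last_calls (rev xs) \<longleftrightarrow> length xs - Suc i \<in> first_calls xs"
  using first_at_rev[of "length xs - Suc i" xs] by (auto simp: first_calls_def last_calls_def)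

lemma in_calls_closed:
  assumes g: "gossip V xs" "noho xs"
    and T: "x \<in> T"
      "\<And>i. i < length xs \<Longrightarrow> i \<notin> first_calls xs \<Longrightarrow> i \<notin> last_calls xs \<Longrightarrow> xs ! i \<inter> T \<noteq> {} \<Longrightarrow> xs ! i \<subseteq> T"
    and f: "\<And>i. last_at xs i x \<Longrightarrow> xs ! i \<subseteq> T"
    and i: "i \<in> in_calls xs x" "i \<notin> first_calls xs" "i \<notin> last_calls xs"
  shows "xs ! i \<subseteq> T"
proof -
  have il: "i < length xs" using i by (simp add: in_calls_def)
  have "rev xs ! (length xs - Suc i) \<subseteq> T"
  proof (rule out_calls_closed[of V _ x])
    show "gossip V (rev xs)" "noho (rev xs)" using g by (simp_all add: gossip_rev noho_rev)
    show "x \<in> T" by fact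
    show "rev xs ! j \<subseteq> T" if "j < length (rev xs)" "j \<notin> first_calls (rev xs)"
      "j \<notin> last_calls (rev xs)"
      "rev xs ! j \<inter> T \<noteq> {}" for j
      using that T(2)[of "length xs - Suc j"] by (simp add: first_calls_rev last_calls_rev rev_nth)
    show "rev xs ! j \<subseteq> T" if "first_at (rev xs) j x" for j
    proof -
      have "j < length xs" using that by (simp add: first_at_def)
      then show ?thesis
        using that f[of "length xs - Suc j"] last_at_rev[of "length xs - Suc j" xs x]
        by (simp add: rev_nth)
    qed
    show "length xs - Suc i \<in> out_calls (rev xs) x" using i(1) in_calls_rev[OF il] by simp
    show "length xs - Suc i \<notin> first_calls (rev xs)" "length xs - Suc i \<notin> last_calls (rev xs)"
      using i il by (simp_all add: first_calls_rev last_calls_rev)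
  qed
  then show ?thesis using il by (simp add: rev_nth)
qed

section \<open>The lower bound of 2n - 4 calls\<close>

lemma sum_degrees:
  assumes "finite V" "calls_on V xs"
  shows "(\<Sum>v\<in>V. card (calls_of xs v)) = 2 * length xs"
proof -
  have "(\<Sum>v\<in>V. card (calls_of xs v)) = (\<Sum>v\<in>V. \<Sum>i<length xs. if v \<in> xs ! i then 1 else 0)"
    by (intro sum.cong refl) (simp add: calls_of_def sum.If_cases Int_def)
  also have "\<dots> = (\<Sum>i<length xs. \<Sum>v\<in>V. if v \<in> xs ! i then 1 else 0)" by (rule sum.swap)
  also have "\<dots> = (\<Sum>i<length xs. 2)"
  proof (intro sum.cong refl)
    fix i assume "i \<in> {..<length xs}"
    then have "xs ! i \<subseteq> V" "card (xs ! i) = 2" using calls_on_nth[OF assms(2)] by auto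
    moreover from this have "V \<inter> xs ! i = xs ! i" by blast
    ultimately show "(\<Sum>v\<in>V. if v \<in> xs ! i then 1 else 0) = (2::nat)"
      using assms(1) by (simp add: sum.If_cases)
  qed
  finally show ?thesis by simp
qed

lemma noho_lower_bound:
  assumes g: "gossip V xs" "noho xs" and V: "V \<noteq> {}"
  shows "2 * card V \<le> length xs + 4"
proof (rule ccontr)
  assume "\<not> ?thesis"
  then have m: "length xs + 5 \<le> 2 * card V" by simp
  have fin: "finite V" and on: "calls_on V xs" using g by (auto simp: gossip_def)
  have deg3: "3 \<le> card (calls_of xs v)" if "v \<in> V" for v
    using degree_noho[OF g that, of "{}"] m by simp
  then have ne: "calls_of xs v \<noteq> {}" if "v \<in> V" for v using that by fastforce
  let ?F = "first_calls xs" and ?L = "last_calls xs"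
  define I where "I = {..<length xs} - ?F - ?L"
  \<comment> \<open>By mutuality a call that is first for one participant is first for both, and
    likewise for last calls. So each person has just one call in \<open>?F\<close> and one in
    \<open>?L\<close>.\<close>
  have firstD: "first_at xs i v" if "i \<in> ?F" "v \<in> xs ! i" for i v
    using that first_at_mutual[OF g] by (auto simp: first_calls_def)
  have lastD: "last_at xs i v" if "i \<in> ?L" "v \<in> xs ! i" for i v
    using that last_at_mutual[OF g] by (auto simp: last_calls_def)
  have disj: "?F \<inter> ?L = {}"
  proof (rule ccontr)
    assume "?F \<inter> ?L \<noteq> {}"
    then obtain i x where i: "i \<in> ?L" "first_at xs i x" by (auto simp: first_calls_def)
    then have "x \<in> xs ! i" "i < length xs" by (auto simp: first_at_def)
    then have x: "x \<in> V" "last_at xs i x" using calls_on_nth[OF on] lastD i by blast+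
    then have "calls_of xs x \<subseteq> {i}" using i(2)
      by (auto simp: calls_of_def first_at_def last_at_def) (metis linorder_neqE_nat)
    then have "card (calls_of xs x) \<le> card {i}" by (intro card_mono) auto
    then show False using deg3[OF x(1)] by simp
  qed
  have cF: "card V \<le> 2 * card ?F"
  proof (intro cover_card[OF on] first_calls_sub)
    fix v assume "v \<in> V"
    then obtain i where "first_at xs i v" using first_at_exists[OF ne] by blast
    then show "\<exists>i\<in>?F. v \<in> xs ! i" by (auto simp: first_calls_def first_at_def)
  qed
  have cL: "card V \<le> 2 * card ?L"
  proof (intro cover_card[OF on] last_calls_sub)
    fix v assume "v \<in> V"
    then obtain i where "last_at xs i v" using last_at_exists[OF ne] by blast
    then show "\<exists>i\<in>?L. v \<in> xs ! i" by (auto simp: last_calls_def last_at_def)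
  qed
  have finF: "finite ?F" and finL: "finite ?L"
    using first_calls_sub[of xs] last_calls_sub[of xs] finite_subset by blast+
  have "card I + card (?F \<union> ?L) = length xs"
  proof -
    have "card (I \<union> (?F \<union> ?L)) = card I + card (?F \<union> ?L)"
      using finF finL by (intro card_Un_disjoint) (auto simp: I_def)
    moreover have "I \<union> (?F \<union> ?L) = {..<length xs}"
      using first_calls_sub[of xs] last_calls_sub[of xs] by (auto simp: I_def)
    ultimately show ?thesis by simp
  qed
  moreover have "card (?F \<union> ?L) = card ?F + card ?L"
    using disj finF finL by (intro card_Un_disjoint)
  \<comment> \<open>\<open>?F\<close> and \<open>?L\<close> each contain at least half of
    \<open>card V\<close> calls, so at most \<open>length xs - card V\<close> middle calls
    remain.\<close>
  ultimately have cI: "card I + 5 \<le> card V" using cF cL m by simp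
  have mid: "\<exists>i\<in>I. z \<in> xs ! i" if z: "z \<in> V" for z
  proof (rule ccontr)
    assume no: "\<not> ?thesis"
    obtain i j where ij: "first_at xs i z" "last_at xs j z"
      using first_at_exists[OF ne[OF z]] last_at_exists[OF ne[OF z]] by blast
    have "calls_of xs z \<subseteq> {i, j}"
    proof
      fix k assume "k \<in> calls_of xs z"
      then have k: "k < length xs" "z \<in> xs ! k" by (auto simp: calls_of_def)
      then have "k \<in> ?F \<or> k \<in> ?L" using no by (auto simp: I_def)
      then show "k \<in> {i, j}"
        using firstD[OF _ k(2)] lastD[OF _ k(2)] first_at_unique[OF ij(1)] last_at_unique[OF ij(2)]
          by blast
    qed
    then have "card (calls_of xs z) \<le> card {i, j}" by (intro card_mono) auto
    also have "\<dots> \<le> 2" by (simp add: card_insert_if)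
    finally show False using deg3[OF z] by simp
  qed
  have deg4: "4 \<le> card (calls_of xs x)" if x: "x \<in> V" for x
  proof -
    obtain i j where ij: "first_at xs i x" "last_at xs j x"
      using first_at_exists[OF ne[OF x]] last_at_exists[OF ne[OF x]] by blast
    then have l: "i < length xs" "x \<in> xs ! i" "j < length xs" "x \<in> xs ! j"
      by (auto simp: first_at_def last_at_def)
    obtain y where y: "xs ! i = {x, y}"
      using calls_on_nth[OF on l(1)] card_2_other[OF _ l(2)] by blast
    obtain w where w: "xs ! j = {x, w}"
      using calls_on_nth[OF on l(3)] card_2_other[OF _ l(4)] by blast
    note yw = y w calls_on_nth[OF on l(1), THEN conjunct1] calls_on_nth[OF on l(3), THEN conjunct1]
    obtain T where T: "{x, y, w} \<subseteq> T" "T \<subseteq> V" "card T \<le> card {x, y, w} + card I"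
      and cl: "\<And>i. i \<in> I \<Longrightarrow> xs ! i \<inter> T \<noteq> {} \<Longrightarrow> xs ! i \<subseteq> T"
    proof -
      have "I \<subseteq> {..<length xs}" "{x, y, w} \<subseteq> V" using yw by (auto simp: I_def)
      from closed_superset[OF fin on this] that show ?thesis by blast
    qed
    have "card {x, y, w} \<le> 3" by (simp add: card_insert_if)
    \<comment> \<open>The closure of at most three persons under at most \<open>card V - 5\<close>
      calls misses some \<open>z\<close>. A middle call of \<open>z\<close> is not inside
      \<open>T\<close>, hence useless for \<open>x\<close>.\<close>
    then have "card T < card V" using T cI by simp
    then obtain z where z: "z \<in> V" "z \<notin> T" using T(2) by (metis less_irrefl subsetI subset_antisym)
    obtain k where k: "k \<in> I" "z \<in> xs ! k" using mid[OF z(1)] by blast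
    then have k': "k \<notin> ?F" "k \<notin> ?L" "k < length xs" "\<not> xs ! k \<subseteq> T" using z by (auto simp: I_def)
    have "k \<notin> out_calls xs x"
    proof
      assume kout: "k \<in> out_calls xs x"
      have "xs ! k \<subseteq> T"
      proof (rule out_calls_closed[OF g _ _ _ kout k'(1,2)])
        show "xs ! l \<subseteq> T" if "first_at xs l x" for l
          using first_at_unique[OF ij(1) that] yw T(1) by auto
      qed (use T(1) cl in \<open>auto simp: I_def\<close>)
      then show False using k'(4) by simp
    qed
    moreover have "k \<notin> in_calls xs x"
    proof
      assume kin: "k \<in> in_calls xs x"
      have "xs ! k \<subseteq> T"
      proof (rule in_calls_closed[OF g _ _ _ kin k'(1,2)])
        show "xs ! l \<subseteq> T" if "last_at xs l x" for l
          using last_at_unique[OF ij(2) that] yw T(1) by auto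
      qed (use T(1) cl in \<open>auto simp: I_def\<close>)
      then show False using k'(4) by simp
    qed
    ultimately have "2 * card V + card {k} \<le> length xs + card (calls_of xs x) + 2"
      using k' by (intro degree_noho[OF g x]) auto
    then show ?thesis using m by simp
  qed
  have "4 * card V \<le> (\<Sum>v\<in>V. card (calls_of xs v))"
    using sum_bounded_below[of V 4 "\<lambda>v. card (calls_of xs v)"] deg4 by (simp add: mult.commute)
  then show False using sum_degrees[OF fin on] m by simp
qed

text \<open>Merging removes one person and at least two calls, so it preserves a violation of the
  bound; what is left are the sequences with \<open>noho\<close>.\<close>

theorem gossip_lower_bound:
  "gossip V xs \<Longrightarrow> 2 * card V \<le> length xs + 4"
proof (induction "card V" arbitrary: V xs rule: less_induct)
  case less
  show ?case
  proof (cases "noho xs")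
    case True
    then show ?thesis using noho_lower_bound[OF less.prems True] by (cases "V = {}") auto
  next
    case False
    obtain x ys where x: "x \<in> V" "gossip (V - {x}) ys" "length ys + 2 \<le> length xs"
      using gossip_merge[OF less.prems False] by blast
    have "finite V" using less.prems by (simp add: gossip_def)
    then have c: "card V = Suc (card (V - {x}))" using x(1) by (metis card.remove)
    then show ?thesis using less.hyps[OF _ x(2)] x(3) by simp
  qed
qed

section \<open>Construction of call sequences with given degrees\<close>

abbreviation call_deg :: "'v set list \<Rightarrow> 'v \<Rightarrow> nat" where
  "call_deg xs v \<equiv> length (filter (\<lambda>e. v \<in> e) xs)"

definition realizes :: "'v set \<Rightarrow> ('v \<Rightarrow> nat) \<Rightarrow> 'v set list \<Rightarrow> bool" where
  "realizes V d xs \<longleftrightarrow> gossip V xs \<and> (\<forall>v\<in>V. call_deg xs v = d v)"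

lemma call_deg_not_in: "calls_on V xs \<Longrightarrow> v \<notin> V \<Longrightarrow> call_deg xs v = 0"
  by (auto simp: calls_on_def filter_empty_conv)

lemma calls_on_mono: "calls_on V xs \<Longrightarrow> V \<subseteq> W \<Longrightarrow> calls_on W xs"
  by (auto simp: calls_on_def)

lemma call_deg_rev [simp]: "call_deg (rev xs) v = call_deg xs v"
  by (simp flip: rev_filter)

text \<open>
  \<open>c v\<close> prescribes the number of children of \<open>v\<close> in a forest with root set \<open>K\<close>; the calls of the forest
  are made from the roots outwards.
\<close>

lemma forest_exists:
  assumes "finite V" "K \<subseteq> V" "(\<Sum>v\<in>V. c v) = card (V - K)" "V = K \<or> (\<exists>r\<in>K. 1 \<le> c r)"
  shows "\<exists>xs. calls_on V xs \<and> (\<forall>v\<in>V. call_deg xs v = c v + (if v \<in> K then 0 else 1)) \<and>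
    (\<forall>v\<in>V. \<exists>r\<in>K. reach xs r v)"
  using assms
proof (induction "card (V - K)" arbitrary: V c)
  case 0
  then have "V = K" by auto
  then show ?case using 0 by (intro exI[of _ "[]"]) auto
next
  case (Suc N)
  have fin: "finite V" "finite (V - K)" "finite K" using Suc.prems finite_subset by auto
  have "V \<noteq> K" using Suc.hyps(2) by auto
  then obtain r where r: "r \<in> K" "1 \<le> c r" using Suc.prems by blast
  have split: "sum c V = sum c (V - K) + sum c K"
    using sum.subset_diff[OF Suc.prems(2) fin(1)] by simp
  have "c r \<le> sum c K" using member_le_sum[of r K c] r fin by simp
  then have lt: "sum c (V - K) < card (V - K)" using split r Suc.prems(3) by simp
  \<comment> \<open>A root takes one of the \<open>card (V - K)\<close> children, so some non-root
    is a leaf.\<close>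
  have "\<exists>v\<in>V - K. c v = 0"
  proof (rule ccontr)
    assume "\<not> ?thesis"
    then have "1 \<le> c v" if "v \<in> V - K" for v using that by (auto simp: Suc_le_eq)
    then have "card (V - K) \<le> sum c (V - K)" using sum_bounded_below[of "V - K" 1 c] by simp
    then show False using lt by simp
  qed
  then obtain v where v: "v \<in> V" "v \<notin> K" "c v = 0" by blast
  have cN: "card (V - {v} - K) = N"
  proof -
    have "V - {v} - K = (V - K) - {v}" by blast
    then show ?thesis using Suc.hyps(2) v fin(2) by simp
  qed
  \<comment> \<open>Choice of the parent \<open>u\<close> of the leaf \<open>v\<close>. With a
    non-root parent, \<open>r\<close> keeps its child and the condition on the roots survives;
    \<open>r\<close> serves only when no non-root has children.\<close>
  have "\<exists>u\<in>V. 1 \<le> c u \<and> (V - {v} = K \<or> (\<exists>s\<in>K. 1 \<le> (c(u := c u - 1)) s))"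
  proof (cases "\<exists>u\<in>V - K. 1 \<le> c u")
    case True
    then obtain u where u: "u \<in> V - K" "1 \<le> c u" by blast
    then have "u \<noteq> r" using r by blast
    then show ?thesis using u r by (intro bexI[of _ u]) auto
  next
    case False
    then have "sum c (V - K) = 0" by (intro sum.neutral) force
    then have K: "sum c K = Suc N" using split Suc.hyps(2) Suc.prems(3) by simp
    have "V - {v} = K \<or> (\<exists>s\<in>K. 1 \<le> (c(r := c r - 1)) s)"
    proof (rule ccontr)
      assume n: "\<not> ?thesis"
      then have no: "\<not> 1 \<le> (c(r := c r - 1)) s" if "s \<in> K" for s using that by blast
      have "c s = 0" if "s \<in> K - {r}" for s using no[of s] that by simp
      then have "sum c (K - {r}) = 0" by simp
      moreover have "c r = 1" using no[OF r(1)] r(2) by simp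
      ultimately have "N = 0" using K sum.remove[OF fin(3) r(1), of c] by simp
      then have "V - {v} - K = {}" using cN fin by simp
      then show False using n \<open>v \<notin> K\<close> Suc.prems(2) by blast
    qed
    then show ?thesis using r Suc.prems(2) by (intro bexI[of _ r]) auto
  qed
  then obtain u where u: "u \<in> V" "1 \<le> c u" "V - {v} = K \<or> (\<exists>s\<in>K. 1 \<le> (c(u := c u - 1)) s)" by blast
  then have uv: "u \<noteq> v" using v by auto
  let ?c = "c(u := c u - 1)"
  have "sum ?c (V - {v}) = N"
  proof -
    have a: "sum c V = c v + sum c (V - {v})" using v fin by (simp add: sum.remove)
    have b: "sum c (V - {v}) = c u + sum c (V - {v} - {u})" using u uv fin by (simp add: sum.remove)
    have "sum ?c (V - {v}) = ?c u + sum ?c (V - {v} - {u})"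
      using u uv fin by (intro sum.remove) auto
    also have "sum ?c (V - {v} - {u}) = sum c (V - {v} - {u})" by (intro sum.cong) auto
    finally show ?thesis using a b u v Suc.hyps(2) Suc.prems(3) by simp
  qed
  then have "\<exists>xs. calls_on (V - {v}) xs \<and> (\<forall>w\<in>V - {v}. call_deg xs w = ?c w + (if w \<in> K then 0 else 1)) \<and>
      (\<forall>w\<in>V - {v}. \<exists>r\<in>K. reach xs r w)"
    using cN u(3) fin(1) v(2) Suc.prems(2) by (intro Suc.hyps(1)) auto
  then obtain xs where xs: "calls_on (V - {v}) xs"
      "\<And>w. w \<in> V - {v} \<Longrightarrow> call_deg xs w = ?c w + (if w \<in> K then 0 else 1)"
      "\<And>w. w \<in> V - {v} \<Longrightarrow> \<exists>r\<in>K. reach xs r w"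
    by blast
  have "calls_on V (xs @ [{u, v}])" using calls_on_mono[OF xs(1)] u v uv by auto
  moreover have "call_deg (xs @ [{u, v}]) w = c w + (if w \<in> K then 0 else 1)" if "w \<in> V" for w
    using that xs(2)[of w] u uv v call_deg_not_in[OF xs(1), of v] by auto
  moreover have "\<exists>r\<in>K. reach (xs @ [{u, v}]) r w" if "w \<in> V" for w
  proof (cases "w = v")
    case True
    then show ?thesis using xs(3)[of u] u uv by (auto simp: reach_append)
  next
    case False
    then show ?thesis using xs(3)[of w] that by (auto simp: reach_append)
  qed
  ultimately show ?case by blast
qed

section \<open>Distributing the degrees over the two forests\<close>

lemma partial_sum:
  fixes e :: "'v \<Rightarrow> nat"
  assumes "finite A" "k \<le> sum e A"
  shows "\<exists>a. (\<forall>v. a v \<le> e v) \<and> sum a A = k"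
  using assms(2)
proof (induction k)
  case 0
  then show ?case by (intro exI[of _ "\<lambda>_. 0"]) auto
next
  case (Suc k)
  then obtain a where a: "\<forall>v. a v \<le> e v" "sum a A = k" by auto
  have "\<exists>v\<in>A. a v < e v"
  proof (rule ccontr)
    assume "\<not> ?thesis"
    then have "sum e A \<le> sum a A" by (intro sum_mono) (auto simp: not_less)
    then show False using Suc.prems a by simp
  qed
  then obtain v where v: "v \<in> A" "a v < e v" by blast
  have "sum (a(v := Suc (a v))) (A - {v}) = sum a (A - {v})" by (intro sum.cong) auto
  then have "sum (a(v := Suc (a v))) A = Suc k"
    using a(2) sum.remove[OF assms(1) v(1), of a] sum.remove[OF assms(1) v(1), of "a(v := Suc (a v))"] by simp
  then show ?case using a v by (intro exI[of _ "a(v := Suc (a v))"]) auto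
qed

lemma split_excess:
  fixes e :: "'v \<Rightarrow> nat"
  assumes "finite V" "K \<subseteq> V" "sum e V = 2 * N" "1 \<le> N" "2 \<le> sum e K"
  shows "\<exists>a b. (\<forall>v\<in>V. e v = a v + b v) \<and> sum a V = N \<and> sum b V = N \<and>
    (\<exists>r\<in>K. 1 \<le> a r) \<and> (\<exists>r\<in>K. 1 \<le> b r)"
proof -
  have fin: "finite K" "finite (V - K)" using assms finite_subset by auto
  have split: "sum f V = sum f (V - K) + sum f K" for f :: "'v \<Rightarrow> nat"
    using sum.subset_diff[OF assms(2,1)] by simp
  \<comment> \<open>\<open>k\<close> is the share of \<open>a\<close> on \<open>K\<close>: at least
    1 and below \<open>sum e K\<close>, so that both forests give some root a child, yet large
    enough for \<open>V - K\<close> to supply the remaining \<open>N - k\<close>.\<close>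
  define k where "k = max 1 (sum e K - N)"
  have k: "1 \<le> k" "k < sum e K" "k \<le> N" "N - k \<le> sum e (V - K)"
    using assms(3,4,5) split[of e] by (auto simp: k_def)
  obtain a1 where a1: "\<forall>v. a1 v \<le> e v" "sum a1 K = k" using partial_sum[of K k e] fin k by auto
  obtain a2 where a2: "\<forall>v. a2 v \<le> e v" "sum a2 (V - K) = N - k"
    using partial_sum[of "V - K" "N - k" e] fin k by auto
  define a where "a v = (if v \<in> K then a1 v else a2 v)" for v
  define b where "b v = e v - a v" for v
  have e: "e v = a v + b v" for v using a1 a2 by (auto simp: a_def b_def)
  have aK: "sum a K = k" using a1 by (simp add: a_def)
  have "sum a (V - K) = N - k" unfolding a2(2)[symmetric] by (intro sum.cong) (auto simp: a_def)
  then have aV: "sum a V = N" using aK split[of a] k by simp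
  have eab: "sum e X = sum a X + sum b X" for X using e by (simp add: sum.distrib)
  then have "sum b V = N" "sum b K \<noteq> 0" using aV assms(3) aK k by auto
  moreover have "\<exists>r\<in>K. 1 \<le> f r" if "sum f K \<noteq> 0" for f :: "'v \<Rightarrow> nat"
    using that by (metis One_nat_def not_less_eq_eq sum.neutral bot_nat_0.extremum_uniqueI bot_nat_0.extremum)
  moreover have "sum a K \<noteq> 0" using aK k by simp
  ultimately show ?thesis using e aV by blast
qed

text \<open>A person outside the core \<open>K\<close> makes one call as a child in each of two
  forests rooted in \<open>K\<close>, which accounts for the 2; \<open>e\<close> counts calls with
  children in both forests. An excess of 2 on \<open>K\<close> lets each forest leave the
  roots.\<close>

lemma core_extension:
  assumes "finite V" "K \<subseteq> V" "gossip K cs" "sum e V = 2 * card (V - K)" "V = K \<or> 2 \<le> sum e K"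
    and d: "\<And>v. v \<in> V \<Longrightarrow> d v = e v + (if v \<in> K then call_deg cs v else 2)"
  shows "\<exists>xs. realizes V d xs"
proof -
  have "\<exists>a b. (\<forall>v\<in>V. e v = a v + b v) \<and> sum a V = card (V - K) \<and> sum b V = card (V - K) \<and>
    (V = K \<or> (\<exists>r\<in>K. 1 \<le> a r)) \<and> (V = K \<or> (\<exists>r\<in>K. 1 \<le> b r))"
  proof (cases "V = K")
    case True
    then show ?thesis using assms(1,4) by (intro exI[of _ "\<lambda>_. 0"]) auto
  next
    case False
    then have "V - K \<noteq> {}" using assms(2) by blast
    then have "1 \<le> card (V - K)" using assms(1) by (simp add: Suc_le_eq card_gt_0_iff)
    from split_excess[OF assms(1,2,4) this] show ?thesis using False assms(5) by blast
  qed
  then obtain a b where ab: "\<And>v. v \<in> V \<Longrightarrow> e v = a v + b v"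
    "sum a V = card (V - K)" "V = K \<or> (\<exists>r\<in>K. 1 \<le> a r)"
    "sum b V = card (V - K)" "V = K \<or> (\<exists>r\<in>K. 1 \<le> b r)" by blast
  obtain as where as: "calls_on V as" "\<forall>v\<in>V. call_deg as v = a v + (if v \<in> K then 0 else 1)"
    "\<forall>v\<in>V. \<exists>r\<in>K. reach as r v" using forest_exists[OF assms(1,2) ab(2,3)] by blast
  obtain bs where bs: "calls_on V bs" "\<forall>v\<in>V. call_deg bs v = b v + (if v \<in> K then 0 else 1)"
    "\<forall>v\<in>V. \<exists>r\<in>K. reach bs r v" using forest_exists[OF assms(1,2) ab(4,5)] by blast
  \<comment> \<open>Inwards along the first forest, exchange in the core, outwards along the
    second.\<close>
  let ?xs = "rev as @ cs @ bs"
  have cs: "calls_on K cs" "\<forall>r\<in>K. \<forall>s\<in>K. reach cs r s" using assms(3) by (auto simp: gossip_def)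
  have "reach ?xs u v" if u: "u \<in> V" and v: "v \<in> V" for u v
  proof -
    obtain r where "r \<in> K" "reach as r u" using as(3) u by blast
    moreover obtain s where "s \<in> K" "reach bs s v" using bs(3) v by blast
    ultimately show ?thesis using cs(2) by (auto simp: reach_append reach_rev)
  qed
  moreover have "call_deg ?xs v = d v" if "v \<in> V" for v
    using as(2) bs(2) that d[OF that] ab(1)[OF that] call_deg_not_in[OF cs(1), of v] by auto
  moreover have "calls_on V ?xs" using as bs calls_on_mono[OF cs(1) assms(2)] by simp
  ultimately have "realizes V d ?xs" using assms(1) by (simp add: realizes_def gossip_def)
  then show ?thesis ..
qed

lemma sum_excess:
  fixes d :: "'v \<Rightarrow> nat"
  assumes "finite V" "K \<subseteq> V" "\<And>v. v \<in> V \<Longrightarrow> d v = e v + (if v \<in> K then k else 2)"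
  shows "sum d V = sum e V + k * card K + 2 * card (V - K)"
proof -
  have "sum d V = sum e V + (\<Sum>v\<in>V. if v \<in> K then k else 2)"
    using assms(3) by (simp add: sum.distrib)
  also have "(\<Sum>v\<in>V. if v \<in> K then k else 2) = k * card K + 2 * card (V - K)"
    using assms(1) Int_absorb1[OF assms(2)] by (simp add: sum.If_cases Diff_eq)
  finally show ?thesis by simp
qed

section \<open>Degree sequences with 2n - 3 or 2n - 4 calls\<close>

text \<open>The core is a single call between \<open>z\<close> and some \<open>r\<close>, so
  \<open>z\<close> needs only degree 1. If no \<open>r\<close> gave the core an excess of 2, the
  degree sum would be too small.\<close>

lemma realizes_tight:
  assumes "finite V" "3 \<le> card V" "sum d V + 6 = 4 * card V" "z \<in> V" "1 \<le> d z"
    "\<And>v. v \<in> V \<Longrightarrow> v \<noteq> z \<Longrightarrow> 2 \<le> d v"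
  shows "\<exists>xs. realizes V d xs"
proof -
  have dz: "sum d V = d z + sum d (V - {z})" using assms by (simp add: sum.remove)
  have cz: "card V = Suc (card (V - {z}))" using assms by (metis card.remove)
  have "\<exists>r. r \<in> V \<and> r \<noteq> z \<and> 4 \<le> d z + d r"
  proof (rule ccontr)
    assume n: "\<not> ?thesis"
    have "V - {z} \<noteq> {}"
      using cz assms(2)
        by (metis card.empty not_numeral_le_zero Suc_le_mono numeral_3_eq_3 zero_less_Suc not_less)
    then obtain r where "r \<in> V" "r \<noteq> z" by blast
    then have "d z \<le> 1" using n assms(6)[of r] by auto
    then have z1: "d z = 1" using assms(5) by simp
    then have "d v \<le> 2" if "v \<in> V - {z}" for v using n that by force
    then have "sum d (V - {z}) \<le> 2 * card (V - {z})"
      using sum_bounded_above[of "V - {z}" d 2] by simp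
    then show False using dz cz z1 assms(2,3) by simp
  qed
  then obtain r where r: "r \<in> V" "r \<noteq> z" "4 \<le> d z + d r" by blast
  let ?K = "{z, r}"
  define e where "e v = d v - (if v \<in> ?K then 1 else 2)" for v
  have d: "d v = e v + (if v \<in> ?K then 1 else 2)" if "v \<in> V" for v
    using assms(5) assms(6)[OF that] assms(6)[OF r(1,2)] by (auto simp: e_def)
  have K: "?K \<subseteq> V" "card ?K = 2" using assms r by auto
  have cVK: "card V = card (V - ?K) + 2" using K assms(1,2) by (simp add: card_Diff_subset)
  show ?thesis
  proof (rule core_extension[where K = ?K and cs = "[?K]" and e = e])
    show "gossip ?K [?K]" using K by (auto simp: gossip_def)
    show "sum e V = 2 * card (V - ?K)"
      using sum_excess[OF assms(1) K(1) d] K(2) cVK assms(3) by simp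
    show "V = ?K \<or> 2 \<le> sum e ?K" using r by (auto simp: e_def)
    show "d v = e v + (if v \<in> ?K then call_deg [?K] v else 2)" if "v \<in> V" for v
      using d[OF that] by auto
  qed (use assms K in auto)
qed

text \<open>Two disjoint calls, then two calls across; together they form a 4-cycle.\<close>

lemma gossip_four:
  assumes "card K = 4"
  shows "\<exists>cs. gossip K cs \<and> (\<forall>v\<in>K. call_deg cs v = 2)"
proof -
  obtain a b c d where K: "K = {a, b, c, d}" "distinct [a, b, c, d]"
  proof -
    have "finite K" using assms card.infinite by fastforce
    then obtain xs where "set xs = K" "distinct xs" using finite_distinct_list by blast
    moreover from this have "length xs = 4" using assms distinct_card by fastforce
    then obtain a b c d where "xs = [a, b, c, d]"
      by (auto simp: numeral_eq_Suc length_Suc_conv)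
    ultimately show ?thesis using that by auto
  qed
  have "gossip K [{a, b}, {c, d}, {b, c}, {d, a}]"
    using K by (auto simp: gossip_def)
  moreover have "\<forall>v\<in>K. call_deg [{a, b}, {c, d}, {b, c}, {d, a}] v = 2"
    using K by auto
  ultimately show ?thesis by blast
qed

lemma realizes_minimum:
  assumes "finite V" "sum d V + 8 = 4 * card V" "\<And>v. v \<in> V \<Longrightarrow> 2 \<le> d v"
  shows "\<exists>xs. realizes V d xs"
proof -
  define e where "e v = d v - 2" for v
  have d: "d v = e v + 2" if "v \<in> V" for v using assms(3)[OF that] by (simp add: e_def)
  have sd: "sum d V = sum e V + 2 * card V"
    using sum_excess[OF assms(1) subset_refl, of d e 2] d by simp
  have c4: "4 \<le> card V" using sd assms(2) by simp
  have "\<exists>K. K \<subseteq> V \<and> card K = 4 \<and> (V = K \<or> 2 \<le> sum e K)"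
  proof (cases "card V = 4")
    case True
    then show ?thesis by blast
  next
    case False
    then have se: "2 \<le> sum e V" using sd assms(2) c4 by simp
    \<comment> \<open>One person of excess at least 2, or two of positive excess, suffice; they fit
      into a core of four.\<close>
    have "\<exists>S. S \<subseteq> V \<and> card S \<le> 2 \<and> 2 \<le> sum e S"
    proof (cases "\<exists>x\<in>V. 2 \<le> e x")
      case True
      then obtain x where "x \<in> V" "2 \<le> e x" by blast
      then show ?thesis by (intro exI[of _ "{x}"]) auto
    next
      case False
      obtain x where x: "x \<in> V" "e x \<noteq> 0" using se by (metis sum.neutral not_numeral_le_zero)
      have "sum e V = e x + sum e (V - {x})" using x assms(1) by (simp add: sum.remove)
      then have "sum e (V - {x}) \<noteq> 0" using False x se by force
      then obtain y where y: "y \<in> V - {x}" "e y \<noteq> 0" by (metis sum.neutral)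
      then show ?thesis using x by (intro exI[of _ "{x, y}"]) auto
    qed
    then obtain S where S: "S \<subseteq> V" "card S \<le> 2" "2 \<le> sum e S" by blast
    then obtain K where K: "S \<subseteq> K" "K \<subseteq> V" "card K = 4"
      using exists_subset_between[of S 4 V] assms(1) c4 by auto
    then have "sum e S \<le> sum e K" using assms(1) by (intro sum_mono2) (auto intro: finite_subset)
    then show ?thesis using K S by auto
  qed
  then obtain K where K: "K \<subseteq> V" "card K = 4" "V = K \<or> 2 \<le> sum e K" by blast
  obtain cs where cs: "gossip K cs" "\<forall>v\<in>K. call_deg cs v = 2" using gossip_four[OF K(2)] by blast
  have "finite K" using K assms finite_subset by blast
  then have "card V = card (V - K) + 4" using K c4 by (simp add: card_Diff_subset)
  then have "sum e V = 2 * card (V - K)" using sd assms(2) by simp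
  then show ?thesis using core_extension[OF assms(1) K(1) cs(1) _ K(3)] d cs(2) by auto
qed

section \<open>Appending further calls\<close>

lemma realizes_add_call:
  assumes "realizes V (d(i := d i - 1, j := d j - 1)) xs" "i \<in> V" "j \<in> V" "i \<noteq> j" "1 \<le> d i"
    "1 \<le> d j"
  shows "realizes V d (xs @ [{i, j}])"
  using assms by (auto simp: realizes_def gossip_def reach_append)

text \<open>Induction upwards from \<open>realizes_tight\<close>: two degrees are lowered by one and
  a final call restores them. No degree may come to exceed half the sum, so one of the two is
  maximal.\<close>

lemma realizes_many:
  assumes "finite V" "3 \<le> card V" "2 * card V \<le> m + 3" "sum d V = 2 * m" "\<And>v. v \<in> V \<Longrightarrow> d v \<le> m"
    "z \<in> V" "1 \<le> d z" "\<And>v. v \<in> V \<Longrightarrow> v \<noteq> z \<Longrightarrow> 2 \<le> d v"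
  shows "\<exists>xs. realizes V d xs"
  using assms(3-)
proof (induction m arbitrary: d z)
  case 0
  then show ?case using assms(2) by simp
next
  case (Suc m)
  show ?case
  proof (cases "2 * card V = Suc m + 3")
    case True
    then show ?thesis using Suc.prems assms(1,2) by (intro realizes_tight[of V d z]) auto
  next
    case False
    then have m: "2 * card V \<le> m + 3" using Suc.prems(1) by simp
    have "Max (d ` V) \<in> d ` V" using assms(1) Suc.prems(4) by (intro Max_in) auto
    then obtain i where i: "i \<in> V" "d i = Max (d ` V)" by auto
    then have imax: "d v \<le> d i" if "v \<in> V" for v using that assms(1) by simp
    have d3: "3 \<le> d i"
    proof (rule ccontr)
      assume "\<not> ?thesis"
      then have "d v \<le> 2" if "v \<in> V" for v using imax[OF that] by simp
      then have "sum d V \<le> 2 * card V" using sum_bounded_above[of V d 2] by simp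
      then show False using m Suc.prems(2) assms(2) by simp
    qed
    \<comment> \<open>If \<open>z = i\<close>, any other person can take over the role of the one
      allowed degree 1, since \<open>d i\<close> is at least 3.\<close>
    have "\<exists>z'. z' \<in> V \<and> z' \<noteq> i \<and> 1 \<le> d z' \<and> (\<forall>v\<in>V. v \<noteq> z' \<longrightarrow> 2 \<le> d v)"
    proof (cases "z = i")
      case False
      then show ?thesis using Suc.prems by blast
    next
      case True
      have "card (V - {i}) \<noteq> 0" using assms(1,2) i by simp
      then obtain z' where "z' \<in> V - {i}" by (metis card.empty ex_in_conv)
      then show ?thesis using True Suc.prems(6) d3 by (intro exI[of _ z']) force
    qed
    then obtain y where y: "y \<in> V" "y \<noteq> i" "1 \<le> d y" "\<And>v. v \<in> V \<Longrightarrow> v \<noteq> y \<Longrightarrow> 2 \<le> d v" by blast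
    have si: "sum d V = d i + sum d (V - {i})" using assms(1) i by (simp add: sum.remove)
    have ci: "card V = Suc (card (V - {i}))" using assms(1) i by (metis card.remove)
    \<comment> \<open>Otherwise the sum is at most \<open>d i + 1 + 2 * (card V - 2)\<close>, too
      little because \<open>d i\<close> is at most half of it.\<close>
    have "\<exists>j\<in>V - {i}. (if j = y then 1 else 2) < d j"
    proof (rule ccontr)
      assume n: "\<not> ?thesis"
      have "sum d (V - {i}) = d y + sum d (V - {i} - {y})"
        using assms(1) y by (simp add: sum.remove)
      moreover have "sum d (V - {i} - {y}) \<le> 2 * card (V - {i} - {y})"
        using sum_bounded_above[of "V - {i} - {y}" d 2] n by (force simp: not_less)
      moreover have "card (V - {i}) = Suc (card (V - {i} - {y}))"
        using assms(1) y by (metis card.remove finite_Diff Diff_iff singletonD)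
      moreover have "d y \<le> 1" using n y(1,2) by force
      moreover have "d i \<le> Suc m" using Suc.prems i by blast
      ultimately show False using si ci Suc.prems(2) m by simp
    qed
    then obtain j where j: "j \<in> V" "j \<noteq> i" "(if j = y then 1 else 2) < d j" by blast
    let ?d = "d(i := d i - 1, j := d j - 1)"
    have sij: "sum f V = f i + (f j + sum f (V - {i} - {j}))" for f :: "_ \<Rightarrow> nat"
      using assms(1) i j by (simp add: sum.remove)
    have "sum ?d (V - {i} - {j}) = sum d (V - {i} - {j})" by (intro sum.cong) auto
    then have sd: "sum ?d V = 2 * m"
      using sij[of ?d] sij[of d] j d3 Suc.prems(2) by (auto split: if_splits)
    have le: "?d v \<le> m" if v: "v \<in> V" for v
    proof (rule ccontr)
      assume n: "\<not> ?thesis"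
      show False
      proof (cases "v \<in> {i, j}")
        case True
        then show False using n Suc.prems(3)[OF v] j by (auto split: if_splits)
      next
        case False
        \<comment> \<open>By maximality \<open>d i\<close> is then at least \<open>Suc m\<close>
          too, and together with \<open>d j\<close> the sum gets too large.\<close>
        then have "Suc m \<le> d v" using n by simp
        moreover have "d v \<le> sum d (V - {i} - {j})"
          using False v assms(1) by (intro member_le_sum) auto
        ultimately show False using sij[of d] imax[OF v] Suc.prems(2) j by (auto split: if_splits)
      qed
    qed
    have "\<exists>xs. realizes V ?d xs"
    proof (rule Suc.IH[OF m sd le])
      show "y \<in> V" "1 \<le> ?d y" using y j by (auto split: if_splits)
      show "2 \<le> ?d v" if "v \<in> V" "v \<noteq> y" for v
        using y(4)[OF that] that j d3 by (auto split: if_splits)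
    qed
    then show ?thesis using realizes_add_call[of V d i j] i j d3 by (auto split: if_splits)
  qed
qed

section \<open>Call sequences and temporal multigraphs\<close>

lemma call_deg_card: "call_deg xs v = card (calls_of xs v)"
  by (simp add: calls_of_def length_filter_conv_card)

text \<open>The path is prolonged only by a vertex not reached before; the last conjunct therefore
  keeps the vertices distinct. \<open>es\<close> lists positions of calls.\<close>

lemma reach_path:
  assumes "reach xs u v" "calls_on V xs"
  shows "\<exists>vs es. length vs = Suc (length es) \<and> hd vs = u \<and> last vs = v \<and> distinct vs \<and>
    set es \<subseteq> {..<length xs} \<and> (\<forall>i<length es. xs ! (es ! i) = {vs ! i, vs ! Suc i}) \<and>
    sorted es \<and> (\<forall>w\<in>set vs. reach xs u w)"
  using assms
proof (induction xs arbitrary: v rule: rev_induct)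
  case Nil
  then show ?case by (intro exI[of _ "[u]"] exI[of _ "[]"]) auto
next
  case (snoc e xs)
  have IH: "\<exists>vs es. length vs = Suc (length es) \<and> hd vs = u \<and> last vs = w \<and> distinct vs \<and>
    set es \<subseteq> {..<length xs} \<and> (\<forall>i<length es. xs ! (es ! i) = {vs ! i, vs ! Suc i}) \<and>
    sorted es \<and> (\<forall>w\<in>set vs. reach xs u w)" if "reach xs u w" for w
    using snoc.IH[OF that] snoc.prems(2) by simp
  have lt: "es ! i < length xs" if "set es \<subseteq> {..<length xs}" "i < length es" for es :: "nat list"
    and i
    using that nth_mem by blast
  show ?case
  proof (cases "reach xs u v")
    case True
    from IH[OF this] obtain vs es where *: "length vs = Suc (length es)" "hd vs = u" "last vs = v"
      "distinct vs"
      "set es \<subseteq> {..<length xs}" "\<forall>i<length es. xs ! (es ! i) = {vs ! i, vs ! Suc i}"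
      "sorted es" "\<forall>w\<in>set vs. reach xs u w" by blast
    show ?thesis
      using * lt[OF *(5)] by (intro exI[of _ vs] exI[of _ es]) (auto simp: nth_append reach_snoc)
  next
    case False
    then obtain w where w: "v \<in> e" "w \<in> e" "reach xs u w"
      using snoc.prems(1) by (auto simp: reach_snoc)
    have wv: "w \<noteq> v" using w False by blast
    then have e: "e = {w, v}" using w snoc.prems(2) by (auto simp: card_2_iff)
    from IH[OF w(3)] obtain vs es where *: "length vs = Suc (length es)" "hd vs = u" "last vs = w"
      "distinct vs"
      "set es \<subseteq> {..<length xs}" "\<forall>i<length es. xs ! (es ! i) = {vs ! i, vs ! Suc i}"
      "sorted es" "\<forall>w\<in>set vs. reach xs u w" by blast
    have ne: "vs \<noteq> []" using *(1) by auto
    have lw: "vs ! length es = w" using *(1,3) ne by (simp add: last_conv_nth)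
    have "v \<notin> set vs" using *(8) False by blast
    moreover have "sorted (es @ [length xs])" using *(5,7) by (auto simp: sorted_append)
    moreover have "(xs @ [e]) ! ((es @ [length xs]) ! i) = {(vs @ [v]) ! i, (vs @ [v]) ! Suc i}"
      if "i < Suc (length es)" for i
    proof (cases "i = length es")
      case True
      then show ?thesis using *(1) lw e by (simp add: nth_append)
    next
      case False
      then have i: "i < length es" using that by simp
      then show ?thesis using *(1,6) lt[OF *(5) i] by (simp add: nth_append)
    qed
    moreover have "reach (xs @ [e]) u v" by (rule snoc.prems(1))
    ultimately show ?thesis using * ne
      by (intro exI[of _ "vs @ [v]"] exI[of _ "es @ [length xs]"]) (auto simp: reach_snoc)
  qed
qed

lemma realizes_TC_realizable:
  assumes "realizes {1..n} d xs"
  shows "TC_realizable n d"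
proof -
  let ?G = "\<lparr>verts = {1..n}, edges = {..<length xs}, ends = (!) xs\<rparr>"
  have on: "calls_on {1..n} xs" and all: "\<And>u v. u \<in> {1..n} \<Longrightarrow> v \<in> {1..n} \<Longrightarrow> reach xs u v"
    using assms by (auto simp: realizes_def gossip_def)
  have "realization ?G n d"
    using assms calls_on_nth[OF on]
    by (auto simp: realization_def loopless_multigraph_def deg_def realizes_def length_filter_conv_card)
  \<comment> \<open>Position plus 1 as label is positive and differs for all edges.\<close>
  moreover have "proper_labeling ?G Suc"
    by (auto simp: proper_labeling_def labeling_def)
  moreover have "temporally_connected ?G Suc"
    unfolding temporally_connected_def
  proof (intro ballI)
    fix u v assume "u \<in> verts ?G" "v \<in> verts ?G"
    then have uv: "u \<in> {1..n}" "reach xs u v" using all by auto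
    obtain vs es where *: "length vs = Suc (length es)" "hd vs = u" "last vs = v" "distinct vs"
      "set es \<subseteq> {..<length xs}" "\<forall>i<length es. xs ! (es ! i) = {vs ! i, vs ! Suc i}"
      "sorted es" "\<forall>w\<in>set vs. reach xs u w" using reach_path[OF uv(2) on] by blast
    have "set vs \<subseteq> {1..n}" using *(8) reach_in[OF _ on uv(1)] by blast
    moreover have "sorted (map Suc es)" using *(7) by (simp add: sorted_map)
    ultimately show "\<exists>vs es. temporal_path ?G Suc u vs es v"
      using * by (intro exI[of _ vs] exI[of _ es]) (simp add: temporal_path_def path_def)
  qed
  ultimately show ?thesis unfolding TC_realizable_def by blast
qed

section \<open>From temporal multigraphs to call sequences\<close>

lemma realization_calls:
  fixes l :: "nat \<Rightarrow> nat"
  assumes "realization G n d"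
  shows "\<exists>es. set es = edges G \<and> sorted (map l es) \<and> calls_on {1..n} (map (ends G) es) \<and>
    (\<forall>v\<in>{1..n}. call_deg (map (ends G) es) v = d v)"
proof -
  have fin: "finite (edges G)" and G: "\<And>e. e \<in> edges G \<Longrightarrow> ends G e \<subseteq> {1..n} \<and> card (ends G e) = 2"
    and deg: "\<And>v. v \<in> {1..n} \<Longrightarrow> deg G v = d v"
    using assms by (auto simp: realization_def loopless_multigraph_def)
  define es where "es = sort_key l (sorted_list_of_set (edges G))"
  have es: "set es = edges G" "distinct es" "sorted (map l es)" using fin by (auto simp: es_def)
  have "call_deg (map (ends G) es) v = d v" if "v \<in> {1..n}" for v
  proof -
    have "call_deg (map (ends G) es) v = length (filter (\<lambda>e. v \<in> ends G e) es)"
      by (simp add: filter_map comp_def)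
    also have "\<dots> = card (set (filter (\<lambda>e. v \<in> ends G e) es))"
      using es(2) by (intro distinct_card[symmetric]) simp
    also have "set (filter (\<lambda>e. v \<in> ends G e) es) = {e \<in> edges G. v \<in> ends G e}" using es(1) by auto
    finally show ?thesis using deg[OF that] by (simp add: deg_def)
  qed
  moreover have "calls_on {1..n} (map (ends G) es)" using G es(1) by (auto simp: calls_on_def)
  ultimately show ?thesis using es by blast
qed

fun walk :: "('e \<Rightarrow> 'v set) \<Rightarrow> 'v \<Rightarrow> 'e list \<Rightarrow> 'v \<Rightarrow> bool" where
  "walk en u [] v \<longleftrightarrow> u = v"
| "walk en u (e # es) v \<longleftrightarrow> (\<exists>w. en e = {u, w} \<and> walk en w es v)"

lemma walk_of_path:
  "length vs = Suc (length es) \<Longrightarrow> \<forall>i<length es. en (es ! i) = {vs ! i, vs ! Suc i} \<Longrightarrow>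
    walk en (hd vs) es (last vs)"
proof (induction es arbitrary: vs)
  case Nil
  then show ?case by (cases vs) auto
next
  case (Cons e es)
  obtain a b ws where vs: "vs = a # b # ws" using Cons.prems(1) by (auto simp: length_Suc_conv)
  have "walk en (hd (b # ws)) es (last (b # ws))"
  proof (rule Cons.IH)
    show "length (b # ws) = Suc (length es)" using Cons.prems(1) vs by simp
    show "\<forall>i<length es. en (es ! i) = {(b # ws) ! i, (b # ws) ! Suc i}"
      using Cons.prems(2) vs by (metis Suc_less_eq length_Cons nth_Cons_Suc)
  qed
  moreover have "en e = {a, b}" using Cons.prems(2) vs by force
  ultimately show ?case using vs by auto
qed

text \<open>Strictly increasing labels put the edges of the walk in the right order in
  \<open>es\<close>, however ties are broken: if the head of \<open>es\<close> does not start the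
  walk, its label is too small for it to occur later in the walk.\<close>

lemma reach_of_walk:
  fixes l :: "'e \<Rightarrow> nat"
  assumes "walk en u ps v" "sorted_wrt (<) (map l ps)" "set ps \<subseteq> set es" "sorted (map l es)"
  shows "reach (map en es) u v"
  using assms
proof (induction es arbitrary: ps u)
  case Nil
  then show ?case by simp
next
  case (Cons e es)
  show ?case
  proof (cases ps)
    case Nil
    then show ?thesis using Cons.prems(1) by simp
  next
    case (Cons p qs)
    then obtain w where w: "en p = {u, w}" "walk en w qs v" using Cons.prems(1) by auto
    have less: "l p < l q" if "q \<in> set qs" for q using Cons.prems(2) Cons that by auto
    show ?thesis
    proof (cases "p = e")
      case True
      have "set qs \<subseteq> set es" using less Cons.prems(3) Cons True by auto
      then have "reach (map en es) w v" using Cons.IH[of w qs] w Cons.prems(2,4) Cons by simp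
      then show ?thesis using w True by auto
    next
      case False
      then have "p \<in> set es" using Cons.prems(3) Cons by auto
      then have "l e \<le> l p" using Cons.prems(4) by auto
      then have "e \<notin> set ps" using less False Cons by (metis leD set_ConsD)
      then have "set ps \<subseteq> set es" using Cons.prems(3) by auto
      then show ?thesis using Cons.IH[of u ps] Cons.prems by simp
    qed
  qed
qed

lemma TC_realizable_realizes:
  assumes "TC_realizable n d"
  shows "\<exists>xs. realizes {1..n} d xs"
proof -
  obtain G l where G: "realization G n d" "proper_labeling G l" "temporally_connected G l"
    using assms by (auto simp: TC_realizable_def)
  obtain es where es: "set es = edges G" "sorted (map l es)" "calls_on {1..n} (map (ends G) es)"
    "\<forall>v\<in>{1..n}. call_deg (map (ends G) es) v = d v"
    using realization_calls[OF G(1), of l] by blast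
  have V: "verts G = {1..n}" using G(1) by (simp add: realization_def)
  have "reach (map (ends G) es) u v" if uv: "u \<in> {1..n}" "v \<in> {1..n}" for u v
  proof -
    obtain vs ps where "temporal_path G l u vs ps v"
      using G(3) uv unfolding temporally_connected_def V by blast
    then have p: "length vs = Suc (length ps)" "hd vs = u" "last vs = v" "distinct vs"
      "set ps \<subseteq> edges G"
      "\<forall>i<length ps. ends G (ps ! i) = {vs ! i, vs ! Suc i}" "sorted (map l ps)"
      by (auto simp: temporal_path_def path_def)
    \<comment> \<open>Consecutive edges of a path share a vertex and differ because the vertices do,
      so properness makes the labels strictly increasing.\<close>
    have "l (ps ! i) < l (ps ! Suc i)" if i: "Suc i < length ps" for i
    proof -
      have e: "ends G (ps ! i) = {vs ! i, vs ! Suc i}"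
        "ends G (ps ! Suc i) = {vs ! Suc i, vs ! Suc (Suc i)}"
        using p(6) i by auto
      have "vs ! i \<noteq> vs ! Suc i" "vs ! i \<noteq> vs ! Suc (Suc i)"
        using p(1,4) i by (auto simp: nth_eq_iff_index_eq)
      then have "ps ! i \<noteq> ps ! Suc i" using e by auto
      moreover have "ps ! i \<in> edges G" "ps ! Suc i \<in> edges G"
        using p(5) i nth_mem[of i ps] nth_mem[of "Suc i" ps] by auto
      ultimately have "l (ps ! i) \<noteq> l (ps ! Suc i)"
        using G(2) e unfolding proper_labeling_def by blast
      moreover have "l (ps ! i) \<le> l (ps ! Suc i)" using p(7) i by (auto simp: sorted_iff_nth_Suc)
      ultimately show ?thesis by simp
    qed
    then have "sorted_wrt (<) (map l ps)"
      by (subst sorted_wrt_iff_nth_Suc_transp) (auto simp: transp_on_def)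
    then show ?thesis using reach_of_walk walk_of_path[OF p(1,6)] p(2,3,5) es(1,2) by metis
  qed
  then show ?thesis using es by (auto simp: realizes_def gossip_def)
qed

section \<open>Persons of degree one\<close>

text \<open>What arrives at \<open>v\<close> must be at \<open>w\<close> before their call, and what
  leaves \<open>v\<close> must spread from \<open>w\<close> after it.\<close>

lemma degree_one_split:
  assumes "gossip V xs" "v \<in> V" "call_deg xs v = 1"
  shows "\<exists>as w bs. xs = as @ {v, w} # bs \<and> w \<noteq> v \<and> (\<forall>u\<in>V - {v}. reach as u w \<and> reach bs w u)"
proof -
  have on: "calls_on V xs" using assms(1) by (simp add: gossip_def)
  obtain e where "filter (\<lambda>e. v \<in> e) xs = [e]" using assms(3) by (auto simp: length_Suc_conv)
  then obtain as bs where xs: "xs = as @ e # bs" "\<forall>u\<in>set as. v \<notin> u" "v \<in> e"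
    "filter (\<lambda>e. v \<in> e) bs = []"
    unfolding filter_eq_Cons_iff by metis
  then have vas: "v \<notin> \<Union>(set as)" and vbs: "v \<notin> \<Union>(set bs)" by (auto simp: filter_empty_conv)
  have "card e = 2" using on xs(1) by simp
  then obtain w where w: "w \<noteq> v" "e = {v, w}" using card_2_other xs(3) by metis
  have "reach as u w \<and> reach bs w u" if "u \<in> V - {v}" for u
  proof
    have "reach xs u v" "reach xs v u" using assms that by (auto simp: gossip_def)
    then show "reach as u w" "reach bs w u"
      using that w reach_not_occurring[OF _ vas] reach_not_occurring[OF _ vbs]
        reach_not_occurring'[OF _ vas] reach_not_occurring'[OF _ vbs]
      by (auto simp: xs(1) reach_append)
  qed
  then show ?thesis using xs(1) w by blast
qed

lemma card_reached_length:
  assumes "calls_on V xs" "U \<subseteq> {y. reach xs x y}"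
  shows "card U \<le> Suc (length xs)"
proof -
  have "card (out_calls xs x) \<le> card {..<length xs}"
    by (intro card_mono) (auto simp: out_calls_def)
  moreover have "card U \<le> card {y. reach xs x y}"
    using card_reached_le[OF assms(1), of x] assms(2) by (intro card_mono) auto
  ultimately show ?thesis using card_reached_le[OF assms(1), of x] by simp
qed

text \<open>Collecting at \<open>w\<close> and distributing from \<open>w\<close> take at least
  \<open>card V - 2\<close> calls each, besides the call with \<open>v\<close>.\<close>

lemma degree_one_bound:
  assumes "gossip V xs" "v \<in> V" "call_deg xs v = 1"
  shows "2 * card V \<le> length xs + 3"
proof -
  obtain as w bs where xs: "xs = as @ {v, w} # bs" "\<forall>u\<in>V - {v}. reach as u w \<and> reach bs w u"
    using degree_one_split[OF assms] by blast
  have on: "calls_on V as" "calls_on V bs" using assms(1) xs(1) by (auto simp: gossip_def)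
  have "card (V - {v}) \<le> Suc (length (rev as))" "card (V - {v}) \<le> Suc (length bs)"
    using on xs(2) by (intro card_reached_length[where V = V and x = w]; auto simp: reach_rev)+
  moreover have "card V = Suc (card (V - {v}))" using assms by (metis card.remove gossip_def)
  ultimately show ?thesis using xs(1) by simp
qed

text \<open>A \<open>v'\<close> other than \<open>w\<close> calls both before and after the call of
  \<open>v\<close>; \<open>w\<close> itself calls \<open>v\<close> and is also reached by a third
  person.\<close>

lemma degree_one_unique:
  assumes "gossip V xs" "v \<in> V" "call_deg xs v = 1" "v' \<in> V" "v' \<noteq> v" "3 \<le> card V"
  shows "2 \<le> call_deg xs v'"
proof -
  obtain as w bs where xs: "xs = as @ {v, w} # bs" "\<forall>u\<in>V - {v}. reach as u w \<and> reach bs w u"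
    using degree_one_split[OF assms(1-3)] by blast
  have pos: "1 \<le> call_deg ys v'" if "v' \<in> \<Union>(set ys)" for ys
  proof -
    have "filter (\<lambda>e. v' \<in> e) ys \<noteq> []" using that by (auto simp: filter_empty_conv)
    then show ?thesis by (simp add: Suc_le_eq)
  qed
  show ?thesis
  proof (cases "w = v'")
    case False
    have "v' \<in> \<Union>(set as)" using reach_not_occurring[of as v' w] xs(2) assms False by auto
    moreover have "v' \<in> \<Union>(set bs)" using reach_not_occurring'[of bs w v'] xs(2) assms False by auto
    ultimately show ?thesis using pos[of as] pos[of bs] xs(1) by simp
  next
    case True
    have "\<not> V \<subseteq> {v, v'}"
    proof
      assume "V \<subseteq> {v, v'}"
      then have "card V \<le> card {v, v'}" by (intro card_mono) auto
      then show False using assms(5,6) by simp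
    qed
    then obtain u where u: "u \<in> V" "u \<noteq> v" "u \<noteq> v'" by blast
    then have "v' \<in> \<Union>(set as)" using reach_not_occurring'[of as u v'] xs(2) True by auto
    then show ?thesis using pos[of as] xs(1) True by simp
  qed
qed

lemma degree_pos:
  assumes "gossip V xs" "v \<in> V" "2 \<le> card V"
  shows "1 \<le> call_deg xs v"
proof (rule ccontr)
  assume "\<not> ?thesis"
  then have "v \<notin> \<Union>(set xs)" by (auto simp: Suc_le_eq filter_empty_conv)
  then have "V \<subseteq> {v}" using reach_not_occurring[of xs v] assms by (auto simp: gossip_def)
  then have "card V \<le> card {v}" by (intro card_mono) auto
  then show False using assms(3) by simp
qed

section \<open>The two directions of the characterization\<close>

theorem theorem5p2:
  fixes n s :: nat and d :: "nat \<Rightarrow> nat"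
  assumes "multigraphical n d"
    and "s = (\<Sum>i=1..n. d i)"
  shows "TC_realizable n d \<longleftrightarrow>
    (int s = 4 * (int n - 1) - 4 \<and> d n \<ge> 2) \<or>
    (int s \<ge> 4 * (int n - 1) - 2 \<and>
      (n \<le> 2 \<or> (n > 2 \<and> d (n - 1) \<ge> 2 \<and> d n \<ge> 1)))"
    (is "_ \<longleftrightarrow> ?C")
proof -
  have mono: "d j \<le> d i" if "1 \<le> i" "i \<le> j" "j \<le> n" for i j
    using assms(1) that by (auto simp: multigraphical_def degree_sequence_def)
  have deg_sum: "sum d {1..n} = 2 * length xs"
    if "calls_on {1..n} xs" "\<forall>v\<in>{1..n}. call_deg xs v = d v" for xs
  proof -
    have "sum d {1..n} = (\<Sum>v\<in>{1..n}. card (calls_of xs v))"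
      using that(2) by (intro sum.cong) (auto simp: call_deg_card)
    then show ?thesis using sum_degrees[OF _ that(1)] by simp
  qed
  \<comment> \<open>A realization supplies an even sum and bounds each degree by the number of
    edges.\<close>
  obtain m where m: "sum d {1..n} = 2 * m" "\<And>v. v \<in> {1..n} \<Longrightarrow> d v \<le> m"
  proof -
    obtain G where "realization G n d" using assms(1) by (auto simp: multigraphical_def)
    from realization_calls[OF this] obtain xs where xs: "calls_on {1..n} xs"
      "\<forall>v\<in>{1..n}. call_deg xs v = d v"
      by blast
    have "d v \<le> length xs" if "v \<in> {1..n}" for v using xs(2) that length_filter_le[of _ xs] by metis
    then show ?thesis using that deg_sum[OF xs] by blast
  qed
  have s: "s = 2 * m" using assms(2) m(1) by simp
  show ?thesis
  proof
    assume "TC_realizable n d"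
    then obtain xs where xs: "gossip {1..n} xs" "\<And>v. v \<in> {1..n} \<Longrightarrow> call_deg xs v = d v"
      using TC_realizable_realizes unfolding realizes_def by blast
    have len: "length xs = m" using deg_sum[of xs] xs m(1) by (simp add: gossip_def)
    have lb: "2 * n \<le> m + 4" using gossip_lower_bound[OF xs(1)] len by simp
    have pos: "1 \<le> d i" if "i \<in> {1..n}" "2 \<le> n" for i
      using degree_pos[OF xs(1) that(1)] xs(2)[OF that(1)] that(2) by simp
    show ?C
    proof (cases "n \<le> 2")
      case True
      \<comment> \<open>The integer bound on \<open>s\<close> is negative for \<open>n <= 1\<close>
        and asks for one call when \<open>n = 2\<close>.\<close>
      then have "n = 2 \<longrightarrow> 1 \<le> m" using pos[of 2] m(2)[of 2] by auto
      then show ?thesis using True s by auto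
    next
      case False
      then have n: "3 \<le> n" "n \<in> {1..n}" "n - 1 \<in> {1..n}" "n - 1 \<noteq> n" by auto
      have dn: "1 \<le> d n" using pos n by simp
      have d1: "2 \<le> d (n - 1)"
      proof (cases "d n = 1")
        case True
        then show ?thesis using degree_one_unique[OF xs(1) n(2) _ n(3,4)] xs(2) n by simp
      next
        case False
        then show ?thesis using dn mono[of "n - 1" n] n by simp
      qed
      show ?thesis
      proof (cases "2 * n \<le> m + 3")
        case True
        then show ?thesis using s d1 dn n by simp
      next
        case F: False
        \<comment> \<open>Here \<open>m = 2 * n - 4\<close>, one call too few for a person of degree
          one.\<close>
        have "d n \<noteq> 1" using degree_one_bound[OF xs(1) n(2)] xs(2)[OF n(2)] F len by auto
        then show ?thesis using F lb s dn n by simp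
      qed
    qed
  next
    assume C: ?C
    have "\<exists>xs. realizes {1..n} d xs"
    proof (cases "int s = 4 * (int n - 1) - 4 \<and> d n \<ge> 2")
      case True
      then have "sum d {1..n} + 8 = 4 * card {1..n}" using s m(1) by auto
      moreover have "2 \<le> d v" if "v \<in> {1..n}" for v using True mono[of v n] that by auto
      ultimately show ?thesis by (intro realizes_minimum) auto
    next
      case False
      then have C2: "int s \<ge> 4 * (int n - 1) - 2" "n \<le> 2 \<or> (n > 2 \<and> d (n - 1) \<ge> 2 \<and> d n \<ge> 1)"
        using C by auto
      consider "n = 0" | "n = 1" | "n = 2" | "3 \<le> n" by linarith
      then show ?thesis
      proof cases
        assume "n = 0"
        then show ?thesis by (intro exI[of _ "[]"]) (simp add: realizes_def gossip_def)
      next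
        assume n: "n = 1"
        then have "d 1 = 0" using m by force
        then show ?thesis using n by (intro exI[of _ "[]"]) (simp add: realizes_def gossip_def)
      next
        assume n: "n = 2"
        have V: "{1..n} = {1, 2}" using n by auto
        have "d 1 + d 2 = 2 * m" using m(1) V by simp
        then have "d 1 = m" "d 2 = m" using m(2)[of 1] m(2)[of 2] n by auto
        moreover obtain k where k: "m = Suc k" using C2(1) s n by (cases m) auto
        ultimately have "realizes {1..n} d (replicate m {1, 2})"
          unfolding V by (auto simp: realizes_def gossip_def calls_on_def)
        then show ?thesis ..
      next
        assume n: "3 \<le> n"
        then have d: "d (n - 1) \<ge> 2" "d n \<ge> 1" using C2(2) by auto
        have "2 * n \<le> m + 3" using C2(1) s by simp
        moreover have "2 \<le> d v" if "v \<in> {1..n}" "v \<noteq> n" for v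
        proof -
          have "1 \<le> v" "v \<le> n - 1" using that by auto
          then show ?thesis using d(1) mono[of v "n - 1"] by simp
        qed
        ultimately show ?thesis using realizes_many[of "{1..n}" m d n] m n d(2) by auto
      qed
    qed
    then show "TC_realizable n d" using realizes_TC_realizable by blast
  qed
qed

end
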